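(* Let $A\in\mathbb{R}^{n\times n}$ be Schur stable and let $C\in\mathbb{R}^{m\times n}$ be such that $(A,C)$ is observable. Let $Q$ be the unique positive definite solution of $A^\top QA-Q+C^\top C=0$ (which exists under these hypotheses). Then there exist $\alpha>0$ and constants $\mu,\lambda>0$ such that every sequence defined by $$X_{k+1}=A^\top X_kA+\alpha\,\mathrm{tr}(X_k)\,C^\top C,\qquad k\ge1,\quad X_1\in\mathbb{S}_+^n\setminus\{0\},$$ satisfies $$d_{\mathcal H}(X_k,Q)\le\mu\,e^{-\lambda k}\,d_{\mathcal H}(X_1,Q)\qquad\text{for all }k\ge1.$$
   Context: $\mathbb{S}_+^n$ is the cone of real symmetric positive semidefinite $n\times n$ matrices, and $X\preceq Y$ means $Y-X\in\mathbb{S}_+^n$. $A$ is Schur stable if all its eigenvalues lie in the open unit disk. The pair $(A,C)$ is observable if the stacked matrix $\mathrm{col}(C,CA,\dots,CA^{n-1})$ has full (column) rank $n$. For $X,Y\in\mathbb{S}_+^n\setminus\{0\}$ let $M(X/Y)=\inf\{\lambda: X\preceq\lambda Y\}$ and $m(X/Y)=\sup\{\mu:\mu Y\preceq X\}$. The Hilbert metric is $d_{\mathcal H}(X,Y)=\ln\frac{M(X/Y)}{m(X/Y)}\in[0,\infty]$, with value $+\infty$ if $M(X/Y)=\infty$ or $m(X/Y)=0$. *)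

theory Defs
  imports
    Complex_Main
    "HOL-Library.Extended_Real"
    "Jordan_Normal_Form.Char_Poly"
    "Jordan_Normal_Form.DL_Rank"
begin

definition psd :: "nat \<Rightarrow> real mat set" where
  "psd n = {X \<in> carrier_mat n n. X\<^sup>T = X \<and> (\<forall>v \<in> carrier_vec n. 0 \<le> v \<bullet> (X *\<^sub>v v))}"

definition pos_def :: "nat \<Rightarrow> real mat \<Rightarrow> bool" where
  "pos_def n X \<longleftrightarrow> X \<in> carrier_mat n n \<and> X\<^sup>T = X \<and>
     (\<forall>v \<in> carrier_vec n. v \<noteq> 0\<^sub>v n \<longrightarrow> 0 < v \<bullet> (X *\<^sub>v v))"

definition loewner_le :: "nat \<Rightarrow> real mat \<Rightarrow> real mat \<Rightarrow> bool" where
  "loewner_le n X Y \<longleftrightarrow> Y - X \<in> psd n"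

definition mat_trace :: "real mat \<Rightarrow> real" where
  "mat_trace X = (\<Sum>i<dim_row X. X $$ (i, i))"

(* All complex eigenvalues of the real matrix A are meant, hence the complexification. *)
definition schur_stable :: "real mat \<Rightarrow> bool" where
  "schur_stable A \<longleftrightarrow> (\<forall>z. eigenvalue (map_mat complex_of_real A) z \<longrightarrow> cmod z < 1)"

(* Row i of col(C, CA, ..., CA^(n-1)) is row (i mod m) of the block C A^(i div m). *)
definition obs_mat :: "nat \<Rightarrow> nat \<Rightarrow> real mat \<Rightarrow> real mat \<Rightarrow> real mat" where
  "obs_mat n m A C = mat (m * n) n (\<lambda>(i, j). (C * (A ^\<^sub>m (i div m))) $$ (i mod m, j))"

definition observable :: "nat \<Rightarrow> nat \<Rightarrow> real mat \<Rightarrow> real mat \<Rightarrow> bool" where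
  "observable n m A C \<longleftrightarrow> vec_space.rank (m * n) (obs_mat n m A C) = n"

(* The infimum and supremum are taken in ereal, so that an empty set of admissible
   factors in hilbert_M gives \<infinity>. *)
definition hilbert_M :: "nat \<Rightarrow> real mat \<Rightarrow> real mat \<Rightarrow> ereal" where
  "hilbert_M n X Y = Inf {ereal l | l. loewner_le n X (l \<cdot>\<^sub>m Y)}"

definition hilbert_m :: "nat \<Rightarrow> real mat \<Rightarrow> real mat \<Rightarrow> ereal" where
  "hilbert_m n X Y = Sup {ereal u | u. loewner_le n (u \<cdot>\<^sub>m Y) X}"

(* Only meaningful for nonzero X, Y in psd n; there 0 \<le> hilbert_m < \<infinity> and 0 < hilbert_M,
   so in the second branch both values are positive reals. *)
definition hilbert_dist :: "nat \<Rightarrow> real mat \<Rightarrow> real mat \<Rightarrow> ereal" where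
  "hilbert_dist n X Y =
     (if hilbert_M n X Y = \<infinity> \<or> hilbert_m n X Y = 0 then \<infinity>
      else ereal (ln (real_of_ereal (hilbert_M n X Y) / real_of_ereal (hilbert_m n X Y))))"

definition lyapunov_solution :: "nat \<Rightarrow> real mat \<Rightarrow> real mat \<Rightarrow> real mat \<Rightarrow> bool" where
  "lyapunov_solution n A C Q \<longleftrightarrow> pos_def n Q \<and> A\<^sup>T * Q * A - Q + C\<^sup>T * C = 0\<^sub>m n n"

end

theory Submission
  imports Defs "Jordan_Normal_Form.Spectral_Radius"
begin

text \<open>Choosing \<open>\<alpha> = 1 / tr Q\<close> makes \<open>Q\<close> a fixed point of the linear, order-preserving map
  \<open>T X = A\<^sup>T X A + \<alpha> tr(X) C\<^sup>T C\<close>.  Write \<open>\<tau> X = tr X / tr Q\<close>.  Observability makes the Gramian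
  \<open>\<Sum>l<n. (A\<^sup>l)\<^sup>T C\<^sup>T C A\<^sup>l\<close> positive definite, so \<open>T\<^sup>n Y \<succeq> c \<tau>(Y) Q\<close> for every positive
  semidefinite \<open>Y\<close> with a constant \<open>c \<in> (0, 1)\<close>.  If \<open>a Q \<preceq> X \<preceq> b Q\<close>, applying this to \<open>X - a Q\<close> and
  \<open>b Q - X\<close> gives \<open>a' Q \<preceq> T\<^sup>n X \<preceq> b' Q\<close> with \<open>a' = (1 - c) a + c \<tau>(X)\<close> and
  \<open>b' = (1 - c) b + c \<tau>(X)\<close>.  Since also \<open>X \<preceq> K \<tau>(X) Q\<close> one may take \<open>b \<le> K \<tau>(X)\<close>, and then
  concavity of the logarithm gives \<open>ln (b' / a') \<le> (1 - \<theta>) ln (b / a)\<close> with a uniform \<open>\<theta>\<close>.\<close>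

section \<open>Quadratic forms of real matrices\<close>

definition quad :: "real mat \<Rightarrow> real vec \<Rightarrow> real" where
  "quad X v = v \<bullet> (X *\<^sub>v v)"

lemma quad_entries:
  assumes "X \<in> carrier_mat n n" "v \<in> carrier_vec n"
  shows "quad X v = (\<Sum>i<n. \<Sum>j<n. v $ i * X $$ (i, j) * v $ j)"
  using assms unfolding quad_def
  by (auto simp: scalar_prod_def sum_distrib_left mult.assoc lessThan_atLeast0 intro!: sum.cong)

lemma quad_add:
  assumes "X \<in> carrier_mat n n" "Y \<in> carrier_mat n n" "v \<in> carrier_vec n"
  shows "quad (X + Y) v = quad X v + quad Y v"
  using assms by (simp add: quad_entries[of _ n] sum.distrib distrib_left distrib_right)

lemma quad_smult:
  assumes "X \<in> carrier_mat n n" "v \<in> carrier_vec n"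
  shows "quad (a \<cdot>\<^sub>m X) v = a * quad X v"
  using assms by (simp add: quad_entries[of _ n] sum_distrib_left mult_ac)

lemma quad_minus:
  assumes "X \<in> carrier_mat n n" "Y \<in> carrier_mat n n" "v \<in> carrier_vec n"
  shows "quad (X - Y) v = quad X v - quad Y v"
  using assms by (simp add: quad_entries[of _ n] minus_carrier_mat sum_subtractf left_diff_distrib right_diff_distrib)

lemma quad_congruence:
  assumes "B \<in> carrier_mat n n" "X \<in> carrier_mat n n" "v \<in> carrier_vec n"
  shows "quad (B\<^sup>T * X * B) v = quad X (B *\<^sub>v v)"
proof -
  have "quad (B\<^sup>T * X * B) v = v \<bullet> (B\<^sup>T *\<^sub>v (X *\<^sub>v (B *\<^sub>v v)))"
    using assms by (simp add: quad_def assoc_mult_mat_vec[where ?n\<^sub>1.0=n and ?n\<^sub>2.0=n and ?n\<^sub>3.0=n])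
  also have "\<dots> = (B\<^sup>T *\<^sub>v (X *\<^sub>v (B *\<^sub>v v))) \<bullet> v"
    using assms by (intro comm_scalar_prod[of _ n]) auto
  also have "\<dots> = (X *\<^sub>v (B *\<^sub>v v)) \<bullet> (B *\<^sub>v v)"
    using assms by (intro transpose_vec_mult_scalar[of _ n n]) auto
  also have "\<dots> = quad X (B *\<^sub>v v)"
    unfolding quad_def using assms by (intro comm_scalar_prod[of _ n]) auto
  finally show ?thesis .
qed

lemma quad_gram:
  assumes "C \<in> carrier_mat m n" "v \<in> carrier_vec n"
  shows "quad (C\<^sup>T * C) v = (C *\<^sub>v v) \<bullet> (C *\<^sub>v v)"
proof -
  have "quad (C\<^sup>T * C) v = v \<bullet> (C\<^sup>T *\<^sub>v (C *\<^sub>v v))"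
    using assms by (simp add: quad_def assoc_mult_mat_vec[where ?n\<^sub>1.0=n and ?n\<^sub>2.0=m and ?n\<^sub>3.0=n])
  also have "\<dots> = (C\<^sup>T *\<^sub>v (C *\<^sub>v v)) \<bullet> v"
    using assms by (intro comm_scalar_prod[of _ n]) auto
  also have "\<dots> = (C *\<^sub>v v) \<bullet> (C *\<^sub>v v)"
    using assms by (intro transpose_vec_mult_scalar[of _ m n]) auto
  finally show ?thesis .
qed

lemma scalar_prod_self_nonneg: "0 \<le> v \<bullet> (v :: real vec)"
  by (simp add: scalar_prod_def sum_nonneg)

lemma scalar_prod_self_eq_0:
  assumes "v \<in> carrier_vec n" "v \<bullet> (v :: real vec) = 0"
  shows "v = 0\<^sub>v n"
proof
  fix i assume "i < dim_vec (0\<^sub>v n)"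
  moreover have "\<forall>i\<in>{0..<n}. v $ i * v $ i = 0"
    using assms by (subst sum_nonneg_eq_0_iff[symmetric]) (auto simp: scalar_prod_def)
  ultimately show "v $ i = 0\<^sub>v n $ i" by simp
qed (use assms in simp)

lemma entry_sq_le_scalar_prod:
  assumes "v \<in> carrier_vec n" "i < n"
  shows "v $ i * v $ i \<le> v \<bullet> (v :: real vec)"
  using assms unfolding scalar_prod_def
  by (auto intro!: member_le_sum[of i _ "\<lambda>i. v $ i * v $ i"])

lemma abs_entry_mult_le_scalar_prod:
  assumes v: "v \<in> carrier_vec n" and i: "i < n" "j < n"
  shows "\<bar>v $ i\<bar> * \<bar>v $ j\<bar> \<le> v \<bullet> (v :: real vec)"
proof -
  have "2 * (\<bar>v $ i\<bar> * \<bar>v $ j\<bar>) \<le> v $ i * v $ i + v $ j * v $ j"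
    using sum_squares_bound[of "\<bar>v $ i\<bar>" "\<bar>v $ j\<bar>"] by (simp add: power2_eq_square)
  then show ?thesis
    using entry_sq_le_scalar_prod[OF v i(1)] entry_sq_le_scalar_prod[OF v i(2)] by linarith
qed

lemma abs_quad_le:
  assumes X: "X \<in> carrier_mat n n" and v: "v \<in> carrier_vec n"
    and b: "\<And>i j. i < n \<Longrightarrow> j < n \<Longrightarrow> \<bar>X $$ (i, j)\<bar> \<le> b"
  shows "\<bar>quad X v\<bar> \<le> real (n * n) * b * (v \<bullet> v)"
proof -
  have "\<bar>quad X v\<bar> \<le> (\<Sum>i<n. \<Sum>j<n. \<bar>v $ i * X $$ (i, j) * v $ j\<bar>)"
    unfolding quad_entries[OF X v] by (intro order_trans[OF sum_abs] sum_mono order_refl)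
  also have "\<dots> \<le> (\<Sum>i<n. \<Sum>j<n. b * (v \<bullet> v))"
  proof (intro sum_mono)
    fix i j assume "i \<in> {..<n}" "j \<in> {..<n}"
    then have "\<bar>X $$ (i, j)\<bar> * (\<bar>v $ i\<bar> * \<bar>v $ j\<bar>) \<le> b * (v \<bullet> v)"
      using b[of i j] abs_entry_mult_le_scalar_prod[OF v, of i j] by (intro mult_mono) auto
    then show "\<bar>v $ i * X $$ (i, j) * v $ j\<bar> \<le> b * (v \<bullet> v)"
      by (simp add: abs_mult mult_ac)
  qed
  finally show ?thesis by (simp add: mult_ac)
qed

lemma quad_bounded:
  assumes X: "X \<in> carrier_mat n n"
  obtains K where "K > 0" "\<And>v. v \<in> carrier_vec n \<Longrightarrow> quad X v \<le> K * (v \<bullet> v)"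
proof
  \<comment> \<open>The sum of all absolute entries dominates each of them; the \<open>+ 1\<close>
    in the witness keeps the constant strictly positive even for the zero matrix.\<close>
  define b where "b = (\<Sum>i<n. \<Sum>j<n. \<bar>X $$ (i, j)\<bar>)"
  have b: "\<bar>X $$ (i, j)\<bar> \<le> b" if "i < n" "j < n" for i j
  proof -
    have "\<bar>X $$ (i, j)\<bar> \<le> (\<Sum>j<n. \<bar>X $$ (i, j)\<bar>)"
      using that by (intro member_le_sum) auto
    also have "\<dots> \<le> b"
      unfolding b_def using that
      by (intro member_le_sum[of i "{..<n}" "\<lambda>i. \<Sum>j<n. \<bar>X $$ (i, j)\<bar>"]) (auto intro: sum_nonneg)
    finally show ?thesis .
  qed
  have "0 \<le> b" unfolding b_def by (intro sum_nonneg) auto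
  then show "real (n * n) * b + 1 > 0" by (simp add: add_nonneg_pos)
  fix v :: "real vec" assume v: "v \<in> carrier_vec n"
  have "quad X v \<le> real (n * n) * b * (v \<bullet> v)"
    using abs_quad_le[OF X v b] by simp
  then show "quad X v \<le> (real (n * n) * b + 1) * (v \<bullet> v)"
    using scalar_prod_self_nonneg[of v] by (simp add: algebra_simps)
qed

section \<open>Cauchy-Schwarz inequality and coercivity of positive definite forms\<close>

lemma quad_add_smult_vec:
  assumes X: "X \<in> carrier_mat n n" and sym: "X\<^sup>T = X"
    and v: "v \<in> carrier_vec n" "w \<in> carrier_vec n"
  shows "quad X (v + t \<cdot>\<^sub>v w) = quad X v + 2 * t * (v \<bullet> (X *\<^sub>v w)) + t\<^sup>2 * quad X w"
proof -
  define p q where "p = X *\<^sub>v v" and "q = X *\<^sub>v w"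
  have pq: "p \<in> carrier_vec n" "q \<in> carrier_vec n"
    unfolding p_def q_def using X v by auto
  have "w \<bullet> p = (X\<^sup>T *\<^sub>v w) \<bullet> v"
    unfolding p_def by (rule transpose_vec_mult_scalar[OF X v(1,2), symmetric])
  also have "\<dots> = v \<bullet> q"
    unfolding sym q_def[symmetric] by (rule comm_scalar_prod[OF pq(2) v(1)])
  finally have wp: "w \<bullet> p = v \<bullet> q" .
  have "X *\<^sub>v (v + t \<cdot>\<^sub>v w) = X *\<^sub>v v + X *\<^sub>v (t \<cdot>\<^sub>v w)"
    using X v by (intro mult_add_distrib_mat_vec[of _ n n]) auto
  also have "\<dots> = p + t \<cdot>\<^sub>v q"
    unfolding p_def q_def mult_mat_vec[OF X v(2)] ..
  finally have "quad X (v + t \<cdot>\<^sub>v w) = (v + t \<cdot>\<^sub>v w) \<bullet> (p + t \<cdot>\<^sub>v q)"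
    unfolding quad_def by simp
  also have "\<dots> = v \<bullet> (p + t \<cdot>\<^sub>v q) + t * (w \<bullet> (p + t \<cdot>\<^sub>v q))"
    using v pq by (subst add_scalar_prod_distrib[of _ n]) auto
  also have "\<dots> = v \<bullet> p + t * (v \<bullet> q) + t * (w \<bullet> p + t * (w \<bullet> q))"
  proof -
    have "u \<bullet> (p + t \<cdot>\<^sub>v q) = u \<bullet> p + t * (u \<bullet> q)" if "u \<in> carrier_vec n" for u
      using that pq by (subst scalar_prod_add_distrib[of _ n]) auto
    then show ?thesis using v by simp
  qed
  also have "\<dots> = quad X v + 2 * t * (v \<bullet> q) + t\<^sup>2 * quad X w"
    unfolding wp by (simp add: quad_def p_def q_def power2_eq_square distrib_left)
  finally show ?thesis unfolding q_def .
qed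

text \<open>Along the line \<open>v + t w\<close> the form is a polynomial in \<open>t\<close> of
  degree at most two that never becomes negative; evaluating it at a suitable \<open>t\<close> gives
  the bound, with the degenerate case of vanishing leading coefficient treated apart.\<close>

lemma psd_Cauchy_Schwarz:
  assumes X: "X \<in> psd n" and v: "v \<in> carrier_vec n" "w \<in> carrier_vec n"
  shows "(v \<bullet> (X *\<^sub>v w))\<^sup>2 \<le> quad X v * quad X w"
proof -
  have X': "X \<in> carrier_mat n n" "X\<^sup>T = X" and nn: "\<And>u. u \<in> carrier_vec n \<Longrightarrow> 0 \<le> quad X u"
    using X by (auto simp: psd_def quad_def)
  define b where "b = v \<bullet> (X *\<^sub>v w)"
  have p: "0 \<le> quad X v + 2 * t * b + t\<^sup>2 * quad X w" for t
    using nn[of "v + t \<cdot>\<^sub>v w"] v unfolding b_def by (simp add: quad_add_smult_vec[OF X' v])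
  have c: "0 \<le> quad X w" using nn v by simp
  show ?thesis
  proof (cases "quad X w = 0")
    case True
    have "b = 0"
    proof (rule ccontr)
      assume "b \<noteq> 0"
      \<comment> \<open>At this \<open>t\<close> the polynomial, now of degree at most one, takes
        the value -1.\<close>
      then have "2 * (- (quad X v + 1) / (2 * b)) * b = - (quad X v + 1)" by simp
      then show False using p[of "- (quad X v + 1) / (2 * b)"] True by simp
    qed
    then show ?thesis using True b_def by simp
  next
    case False
    then have c: "0 < quad X w" using c by simp
    \<comment> \<open>The minimiser of the quadratic polynomial is
      \<open>t = - b / quad X w\<close>.\<close>
    have "0 \<le> quad X v - b\<^sup>2 / quad X w"
      using p[of "- b / quad X w"] c by (simp add: power2_eq_square field_simps)
    then show ?thesis using c by (simp add: field_simps b_def)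
  qed
qed

lemma pos_def_imp_psd: "pos_def n X \<Longrightarrow> X \<in> psd n"
proof -
  assume P: "pos_def n X"
  have "0 \<le> v \<bullet> (X *\<^sub>v v)" if "v \<in> carrier_vec n" for v
  proof (cases "v = 0\<^sub>v n")
    case True
    have "X *\<^sub>v v \<in> carrier_vec n" using P that by (auto simp: pos_def_def)
    then show ?thesis using True by simp
  next
    case False
    then show ?thesis using P that by (auto simp: pos_def_def intro: less_imp_le)
  qed
  then show ?thesis using P by (simp add: pos_def_def psd_def)
qed

text \<open>Positivity at each nonzero vector makes \<open>P\<close> injective, hence invertible; an
  upper bound \<open>K\<close> for the form of the inverse \<open>R\<close> turns into the uniform
  lower bound \<open>1 / K\<close> for the form of \<open>P\<close>.\<close>

lemma pos_def_coercive:
  assumes "pos_def n P"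
  obtains e where "e > 0" "\<And>v. v \<in> carrier_vec n \<Longrightarrow> e * (v \<bullet> v) \<le> quad P v"
proof -
  have P: "P \<in> carrier_mat n n" and psd: "P \<in> psd n"
    and pos: "\<And>v. v \<in> carrier_vec n \<Longrightarrow> v \<noteq> 0\<^sub>v n \<Longrightarrow> 0 < quad P v"
    using assms pos_def_imp_psd[OF assms] by (auto simp: pos_def_def quad_def)
  have "det P \<noteq> 0"
    unfolding det_0_iff_vec_prod_zero[OF P] using pos by (fastforce simp: quad_def)
  then obtain R where R: "R \<in> carrier_mat n n" "P * R = 1\<^sub>m n"
    using det_non_zero_imp_unit[OF P, of "()"] by (auto simp: Units_def ring_mat_def)
  obtain K where K: "K > 0" "\<And>v. v \<in> carrier_vec n \<Longrightarrow> quad R v \<le> K * (v \<bullet> v)"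
    using quad_bounded[OF R(1)] by blast
  show ?thesis
  proof
    show "1 / K > 0" using K by simp
    fix v :: "real vec" assume v: "v \<in> carrier_vec n"
    \<comment> \<open>Cauchy-Schwarz for \<open>P\<close> applied to \<open>v\<close> and \<open>P\<^sup>-\<^sup>1 v\<close> replaces compactness of the unit sphere.\<close>
    define s where "s = v \<bullet> v"
    have Rv: "R *\<^sub>v v \<in> carrier_vec n" using R v by simp
    have PR: "P *\<^sub>v (R *\<^sub>v v) = v"
      using R v P by (metis assoc_mult_mat_vec one_mult_mat_vec)
    have "quad P (R *\<^sub>v v) = quad R v"
      unfolding quad_def PR using comm_scalar_prod[OF Rv v] by simp
    then have "s\<^sup>2 \<le> quad P v * quad R v"
      using psd_Cauchy_Schwarz[OF psd v Rv] by (simp add: PR s_def)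
    also have "\<dots> \<le> quad P v * (K * s)"
      using K(2)[OF v] psd v by (intro mult_left_mono) (auto simp: psd_def quad_def s_def)
    finally have *: "s * s \<le> (K * quad P v) * s" by (simp add: power2_eq_square mult_ac)
    have "s \<le> K * quad P v"
    proof (cases "s = 0")
      case True
      then show ?thesis using psd v K(1) by (auto simp: psd_def quad_def)
    next
      case False
      then have "s > 0" using scalar_prod_self_nonneg[of v] by (simp add: s_def)
      then show ?thesis using * by simp
    qed
    then show "1 / K * (v \<bullet> v) \<le> quad P v" using K(1) by (simp add: s_def field_simps)
  qed
qed

section \<open>Trace and the Loewner order\<close>

lemma loewner_le_iff:
  assumes "X \<in> carrier_mat n n" "X\<^sup>T = X" "Y \<in> carrier_mat n n" "Y\<^sup>T = Y"
  shows "loewner_le n X Y \<longleftrightarrow> (\<forall>v\<in>carrier_vec n. quad X v \<le> quad Y v)"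
  using assms
  by (auto simp: loewner_le_def psd_def quad_def[symmetric] quad_minus transpose_minus[of _ n n])

lemma quad_unit_vec:
  assumes "X \<in> carrier_mat n n" "i < n"
  shows "quad X (unit_vec n i) = X $$ (i, i)"
  using assms by (simp add: quad_def)

lemma mat_trace_eq_sum_quad:
  assumes "X \<in> carrier_mat n n"
  shows "mat_trace X = (\<Sum>i<n. quad X (unit_vec n i))"
  using assms by (simp add: mat_trace_def quad_unit_vec)

lemma psd_quad_nonneg: "X \<in> psd n \<Longrightarrow> v \<in> carrier_vec n \<Longrightarrow> 0 \<le> quad X v"
  by (simp add: psd_def quad_def)

lemma psd_trace_nonneg:
  assumes "X \<in> psd n"
  shows "0 \<le> mat_trace X"
proof -
  have "X \<in> carrier_mat n n" using assms by (simp add: psd_def)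
  then show ?thesis
    using psd_quad_nonneg[OF assms] by (auto simp: mat_trace_eq_sum_quad intro!: sum_nonneg)
qed

text \<open>Cauchy-Schwarz at two unit vectors bounds the squared entry by the product of two
  diagonal entries. These are nonnegative, so each is at most the trace.\<close>

lemma psd_abs_entry_le_trace:
  assumes X: "X \<in> psd n" and ij: "i < n" "j < n"
  shows "\<bar>X $$ (i, j)\<bar> \<le> mat_trace X"
proof -
  have X': "X \<in> carrier_mat n n" using X by (simp add: psd_def)
  have diag: "0 \<le> X $$ (k, k)" "X $$ (k, k) \<le> mat_trace X" if "k < n" for k
  proof -
    have *: "0 \<le> X $$ (k, k)" if "k < n" for k
      using psd_quad_nonneg[OF X, of "unit_vec n k"] X' that by (simp add: quad_unit_vec)
    then show "0 \<le> X $$ (k, k)" using that by blast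
    show "X $$ (k, k) \<le> mat_trace X"
      unfolding mat_trace_def using X' * that by (auto intro!: member_le_sum[of k _ "\<lambda>k. X $$ (k, k)"])
  qed
  have e: "unit_vec n i \<bullet> (X *\<^sub>v unit_vec n j) = X $$ (i, j)"
    using X' ij by simp
  have "\<bar>X $$ (i, j)\<bar>\<^sup>2 \<le> X $$ (i, i) * X $$ (j, j)"
    using psd_Cauchy_Schwarz[OF X, of "unit_vec n i" "unit_vec n j"] X' ij e
    by (simp add: quad_unit_vec)
  also have "\<dots> \<le> (mat_trace X)\<^sup>2"
    unfolding power2_eq_square using diag ij psd_trace_nonneg[OF X] by (intro mult_mono)
  finally show ?thesis using psd_trace_nonneg[OF X] by (rule power2_le_imp_le)
qed

lemma psd_quad_le_trace:
  assumes X: "X \<in> psd n" and v: "v \<in> carrier_vec n"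
  shows "quad X v \<le> real (n * n) * mat_trace X * (v \<bullet> v)"
  using abs_quad_le[OF _ v psd_abs_entry_le_trace[OF X]] X by (auto simp: psd_def)

section \<open>The Lyapunov equation\<close>

lemma congruence_carrier [simp]:
  "B \<in> carrier_mat n n \<Longrightarrow> X \<in> carrier_mat n n \<Longrightarrow> B\<^sup>T * X * B \<in> carrier_mat n n"
  by (intro mult_carrier_mat[of _ n n]) auto

lemma congruence_symmetric:
  fixes B X :: "'a :: comm_semiring_1 mat"
  assumes B: "B \<in> carrier_mat n n" and X: "X \<in> carrier_mat n n" "X\<^sup>T = X"
  shows "(B\<^sup>T * X * B)\<^sup>T = B\<^sup>T * X * B"
proof -
  have "(B\<^sup>T * X * B)\<^sup>T = B\<^sup>T * (B\<^sup>T * X)\<^sup>T"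
    using B X by (intro transpose_mult[of _ n n _ n]) auto
  also have "(B\<^sup>T * X)\<^sup>T = X * B"
    using B X by (subst transpose_mult[of _ n n _ n]) auto
  also have "B\<^sup>T * (X * B) = B\<^sup>T * X * B"
    using B X by (intro assoc_mult_mat[symmetric]) auto
  finally show ?thesis .
qed

lemma congruence_entry:
  assumes "B \<in> carrier_mat n n" "X \<in> carrier_mat n n" "i < n" "j < n"
  shows "(B\<^sup>T * X * B) $$ (i, j) = (\<Sum>a<n. \<Sum>b<n. B $$ (a, i) * X $$ (a, b) * B $$ (b, j))"
  using assms by (simp add: scalar_prod_def lessThan_atLeast0 sum_distrib_left mult.assoc)

section \<open>Geometric decay for powers of a Schur stable matrix\<close>

lemma congruence_pow_Suc:
  fixes A X :: "'a :: comm_semiring_1 mat"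
  assumes A: "A \<in> carrier_mat n n" and X: "X \<in> carrier_mat n n"
  shows "(A ^\<^sub>m Suc k)\<^sup>T * X * A ^\<^sub>m Suc k = A\<^sup>T * ((A ^\<^sub>m k)\<^sup>T * X * A ^\<^sub>m k) * A"
proof -
  define P where "P = A ^\<^sub>m k"
  have P: "P \<in> carrier_mat n n" "P\<^sup>T \<in> carrier_mat n n" "A\<^sup>T \<in> carrier_mat n n"
    using A by (auto simp: P_def)
  have "(P * A)\<^sup>T * X * (P * A) = A\<^sup>T * P\<^sup>T * X * (P * A)"
    using transpose_mult[OF P(1) A] by simp
  also have "A\<^sup>T * P\<^sup>T * X = A\<^sup>T * (P\<^sup>T * X)"
    using P X by (intro assoc_mult_mat) auto
  also have "A\<^sup>T * (P\<^sup>T * X) * (P * A) = A\<^sup>T * (P\<^sup>T * X) * P * A"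
    using A P X by (intro assoc_mult_mat[symmetric] mult_carrier_mat) auto
  also have "A\<^sup>T * (P\<^sup>T * X) * P = A\<^sup>T * (P\<^sup>T * X * P)"
    using P X by (intro assoc_mult_mat mult_carrier_mat) auto
  finally show ?thesis by (simp add: P_def)
qed

lemma pow_mat_smult:
  fixes A :: "'a :: comm_semiring_1 mat"
  assumes A: "A \<in> carrier_mat n n"
  shows "(a \<cdot>\<^sub>m A) ^\<^sub>m k = a ^ k \<cdot>\<^sub>m (A ^\<^sub>m k)"
proof (induction k)
  case 0
  show ?case by (intro eq_matI) auto
next
  case (Suc k)
  have P: "A ^\<^sub>m k \<in> carrier_mat n n" using A by simp
  have "(a \<cdot>\<^sub>m A) ^\<^sub>m Suc k = (a ^ k \<cdot>\<^sub>m (A ^\<^sub>m k)) * (a \<cdot>\<^sub>m A)"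
    using Suc by simp
  also have "\<dots> = a \<cdot>\<^sub>m ((a ^ k \<cdot>\<^sub>m (A ^\<^sub>m k)) * A)"
    using P A by (intro mult_smult_distrib) auto
  also have "\<dots> = a \<cdot>\<^sub>m (a ^ k \<cdot>\<^sub>m (A ^\<^sub>m k * A))"
    using P A by (subst mult_smult_assoc_mat) auto
  also have "\<dots> = a ^ Suc k \<cdot>\<^sub>m (A ^\<^sub>m Suc k)"
    by (intro eq_matI) (auto simp: mult.assoc)
  finally show ?case .
qed

text \<open>Dividing the matrix by some \<open>r\<close> strictly between its spectral radius and 1
  still leaves a spectral radius below 1, so the scaled powers are bounded; undoing the scaling
  produces the factor \<open>r ^ k\<close>.\<close>

lemma schur_stable_pow_decay:
  assumes A: "A \<in> carrier_mat n n" and st: "schur_stable A"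
  shows "\<exists>c r. 0 < r \<and> r < 1 \<and> (\<forall>k i j. i < n \<longrightarrow> j < n \<longrightarrow> \<bar>(A ^\<^sub>m k) $$ (i, j)\<bar> \<le> c * r ^ k)"
proof (cases "n = 0")
  case True
  show ?thesis by (rule exI, rule exI[of _ "1 / 2"]) (use True in auto)
next
  case False
  define Z where "Z = map_mat complex_of_real A"
  have Z: "Z \<in> carrier_mat n n" using A by (simp add: Z_def)
  have s: "spectral_radius Z < 1" "0 \<le> spectral_radius Z"
    using spectral_radius_mem_max(1)[OF Z] False st by (auto simp: Z_def schur_stable_def spectrum_def)
  \<comment> \<open>The midpoint between the spectral radius and 1 is positive even when the
    spectral radius is 0.\<close>
  define r where "r = (1 + spectral_radius Z) / 2"
  have r: "0 < r" "r < 1" "spectral_radius Z < r" using s by (auto simp: r_def)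
  define B where "B = complex_of_real (1 / r) \<cdot>\<^sub>m Z"
  have B: "B \<in> carrier_mat n n" using Z by (simp add: B_def)
  have "spectral_radius B < 1"
  proof -
    obtain z where z: "eigenvalue B z" "spectral_radius B = cmod z"
      using spectral_radius_mem_max(1)[OF B] False by (auto simp: spectrum_def)
    then obtain v where v: "v \<in> carrier_vec n" "v \<noteq> 0\<^sub>v n" "B *\<^sub>v v = z \<cdot>\<^sub>v v"
      using B by (auto simp: eigenvalue_def eigenvector_def)
    \<comment> \<open>Multiplying an eigenvalue of \<open>B\<close> by \<open>r\<close> gives an
      eigenvalue of \<open>Z\<close>, whose modulus is at most the spectral radius of
      \<open>Z\<close> and so below \<open>r\<close>.\<close>
    have "Z = complex_of_real r \<cdot>\<^sub>m B"
      using r by (intro eq_matI) (auto simp: B_def)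
    then have "Z *\<^sub>v v = complex_of_real r \<cdot>\<^sub>v (B *\<^sub>v v)"
      using B v(1) by (intro eq_vecI) auto
    then have "Z *\<^sub>v v = (complex_of_real r * z) \<cdot>\<^sub>v v"
      using v(3) by (simp add: smult_smult_assoc)
    then have "eigenvalue Z (complex_of_real r * z)"
      using v Z by (auto simp: eigenvalue_def eigenvector_def)
    then have "cmod (complex_of_real r * z) \<le> spectral_radius Z"
      using spectral_radius_mem_max(2)[OF Z] False by (auto simp: spectrum_def)
    moreover have "cmod (complex_of_real r * z) = r * cmod z"
      using r by (simp add: norm_mult)
    ultimately have "r * cmod z < r * 1" using r(3) by linarith
    then have "cmod z < 1" by (rule mult_left_less_imp_less) (use r in simp)
    then show ?thesis unfolding z(2) .
  qed
  then obtain c where c: "\<And>k. norm_bound (B ^\<^sub>m k) c"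
    using spectral_radius_jnf_norm_bound_less_1_upper_triangular[OF B] by auto
  show ?thesis
  proof (rule exI[of _ c], rule exI[of _ r], intro conjI allI impI r(1,2))
    fix k i j assume ij: "i < n" "j < n"
    have Zk: "Z ^\<^sub>m k = map_mat complex_of_real (A ^\<^sub>m k)"
      unfolding Z_def by (rule of_real_hom.mat_hom_pow[OF A, symmetric])
    have "cmod ((B ^\<^sub>m k) $$ (i, j)) \<le> c"
      using c[of k] ij B by (simp add: norm_bound_def)
    also have "(B ^\<^sub>m k) $$ (i, j) = complex_of_real ((1 / r) ^ k * (A ^\<^sub>m k) $$ (i, j))"
      unfolding B_def pow_mat_smult[OF Z] Zk using A ij by simp
    finally have "(1 / r) ^ k * \<bar>(A ^\<^sub>m k) $$ (i, j)\<bar> \<le> c"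
      using r by (simp add: abs_mult del: of_real_mult of_real_power)
    then show "\<bar>(A ^\<^sub>m k) $$ (i, j)\<bar> \<le> c * r ^ k"
      using r by (simp add: field_simps power_divide)
  qed
qed

text \<open>The power of \<open>A\<close> occurs on both sides of \<open>X\<close>, so the rate
  \<open>r\<close> for the powers becomes \<open>r\<^sup>2\<close> here.\<close>

lemma schur_stable_congruence_decay:
  assumes A: "A \<in> carrier_mat n n" and st: "schur_stable A" and X: "X \<in> carrier_mat n n"
  shows "\<exists>c r. 0 < r \<and> r < 1 \<and>
    (\<forall>k i j. i < n \<longrightarrow> j < n \<longrightarrow> \<bar>((A ^\<^sub>m k)\<^sup>T * X * A ^\<^sub>m k) $$ (i, j)\<bar> \<le> c * r ^ k)"
proof -
  obtain r c where r: "0 < r" "r < 1"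
    and c: "\<And>k i j. i < n \<Longrightarrow> j < n \<Longrightarrow> \<bar>(A ^\<^sub>m k) $$ (i, j)\<bar> \<le> c * r ^ k"
    using schur_stable_pow_decay[OF A st] by blast
  define d where "d = (\<Sum>a<n. \<Sum>b<n. c * \<bar>X $$ (a, b)\<bar> * c)"
  show ?thesis
  proof (rule exI[of _ d], rule exI[of _ "r\<^sup>2"], intro conjI allI impI)
    show "0 < r\<^sup>2" "r\<^sup>2 < 1" using r power_strict_mono[of r 1 2] by auto
    fix k i j assume ij: "i < n" "j < n"
    define P where "P = A ^\<^sub>m k"
    have P: "P \<in> carrier_mat n n" using A by (simp add: P_def)
    have "\<bar>(P\<^sup>T * X * P) $$ (i, j)\<bar> \<le> (\<Sum>a<n. \<Sum>b<n. \<bar>P $$ (a, i) * X $$ (a, b) * P $$ (b, j)\<bar>)"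
      unfolding congruence_entry[OF P X ij] by (intro order_trans[OF sum_abs] sum_mono order_refl)
    also have "\<dots> \<le> (\<Sum>a<n. \<Sum>b<n. (c * r ^ k) * \<bar>X $$ (a, b)\<bar> * (c * r ^ k))"
    proof (intro sum_mono)
      fix a b assume ab: "a \<in> {..<n}" "b \<in> {..<n}"
      have p: "\<bar>P $$ (a, i)\<bar> \<le> c * r ^ k" "\<bar>P $$ (b, j)\<bar> \<le> c * r ^ k"
        using c ab ij by (auto simp: P_def)
      \<comment> \<open>The sign of \<open>c\<close> is not part of the decay bound; it follows here
        because \<open>c * r ^ k\<close> dominates an absolute value.\<close>
      then have "0 \<le> c * r ^ k" by linarith
      with p show "\<bar>P $$ (a, i) * X $$ (a, b) * P $$ (b, j)\<bar> \<le> (c * r ^ k) * \<bar>X $$ (a, b)\<bar> * (c * r ^ k)"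
        unfolding abs_mult
        by (intro mult_mono[OF mult_mono[OF p(1) order_refl] p(2)]) (simp_all add: mult_nonneg_nonneg)
    qed
    also have "\<dots> = d * (r\<^sup>2) ^ k"
      unfolding d_def sum_distrib_right
      by (intro sum.cong refl) (simp add: power2_eq_square power_mult_distrib mult_ac)
    finally show "\<bar>((A ^\<^sub>m k)\<^sup>T * X * A ^\<^sub>m k) $$ (i, j)\<bar> \<le> d * (r\<^sup>2) ^ k"
      by (simp add: P_def)
  qed
qed

lemma schur_stable_congruence_summable:
  assumes "A \<in> carrier_mat n n" "schur_stable A" "X \<in> carrier_mat n n" "i < n" "j < n"
  shows "summable (\<lambda>k. ((A ^\<^sub>m k)\<^sup>T * X * A ^\<^sub>m k) $$ (i, j))"
proof -
  obtain r c where r: "0 < r" "r < 1"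
    and c: "\<And>k. \<bar>((A ^\<^sub>m k)\<^sup>T * X * A ^\<^sub>m k) $$ (i, j)\<bar> \<le> c * r ^ k"
    using schur_stable_congruence_decay[OF assms(1-3)] assms(4,5) by blast
  have "summable (\<lambda>k. c * r ^ k)"
    by (rule summable_mult, rule summable_geometric) (use r in simp)
  then show ?thesis
    by (rule summable_comparison_test'[of _ 0]) (unfold real_norm_def, rule c)
qed

lemmas schur_stable_congruence_tendsto_0 =
  summable_LIMSEQ_zero[OF schur_stable_congruence_summable]

section \<open>Existence and uniqueness for the Lyapunov equation\<close>

lemma lyapunov_eq_iff:
  fixes Q :: "real mat"
  assumes "A \<in> carrier_mat n n" "C \<in> carrier_mat m n" "Q \<in> carrier_mat n n"
  shows "A\<^sup>T * Q * A - Q + C\<^sup>T * C = 0\<^sub>m n n \<longleftrightarrow> A\<^sup>T * Q * A + C\<^sup>T * C = Q"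
proof -
  define P G where "P = A\<^sup>T * Q * A" and "G = C\<^sup>T * C"
  have PG: "P \<in> carrier_mat n n" "G \<in> carrier_mat n n"
    using assms by (auto simp: P_def G_def intro!: mult_carrier_mat[of _ n m])
  have "P - Q + G = 0\<^sub>m n n \<longleftrightarrow> (\<forall>i<n. \<forall>j<n. P $$ (i, j) - Q $$ (i, j) + G $$ (i, j) = 0)"
    using PG assms(3) by (auto simp: mat_eq_iff)
  also have "\<dots> \<longleftrightarrow> (\<forall>i<n. \<forall>j<n. P $$ (i, j) + G $$ (i, j) = Q $$ (i, j))"
  proof -
    have "p - q + g = 0 \<longleftrightarrow> p + g = q" for p q g :: real by auto
    then show ?thesis by simp
  qed
  also have "\<dots> \<longleftrightarrow> P + G = Q"
    using PG assms(3) by (auto simp: mat_eq_iff)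
  finally show ?thesis by (simp add: P_def G_def)
qed

text \<open>The solution is the entrywise convergent series of the matrices \<open>M k\<close>.
  Congruence by \<open>A\<close> shifts the series by one index, and adding the term
  \<open>M 0 = G\<close> restores it.\<close>

lemma lyapunov_equation_solvable:
  assumes A: "A \<in> carrier_mat n n" and C: "C \<in> carrier_mat m n" and st: "schur_stable A"
  obtains Q where "Q \<in> carrier_mat n n" "Q\<^sup>T = Q" "A\<^sup>T * Q * A + C\<^sup>T * C = Q"
proof
  define G where "G = C\<^sup>T * C"
  have G: "G \<in> carrier_mat n n" using C by (simp add: G_def)
  have GT: "G\<^sup>T = G" using C by (simp add: G_def transpose_mult[of _ n m _ n])
  define M where "M k = (A ^\<^sub>m k)\<^sup>T * G * A ^\<^sub>m k" for k
  have M: "M k \<in> carrier_mat n n" for k using A G by (simp add: M_def)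
  have MT: "(M k)\<^sup>T = M k" for k
    unfolding M_def by (rule congruence_symmetric[OF _ G GT]) (use A in simp)
  have sm: "summable (\<lambda>k. M k $$ (i, j))" if "i < n" "j < n" for i j
    unfolding M_def using schur_stable_congruence_summable[OF A st G that] .
  define Q where "Q = mat n n (\<lambda>(i, j). \<Sum>k. M k $$ (i, j))"
  show Q: "Q \<in> carrier_mat n n" by (simp add: Q_def)
  have sym: "M k $$ (i, j) = M k $$ (j, i)" if "i < n" "j < n" for i j k
    using arg_cong[OF MT[of k], of "\<lambda>X. X $$ (i, j)"] M[of k] that by simp
  show "Q\<^sup>T = Q"
    by (intro eq_matI) (auto simp: Q_def sym)
  show "A\<^sup>T * Q * A + C\<^sup>T * C = Q"
  proof (intro eq_matI)
    fix i j assume "i < dim_row Q" "j < dim_col Q"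
    then have ij: "i < n" "j < n" by (auto simp: Q_def)
    have lhs: "(A\<^sup>T * Q * A) $$ (i, j) = (\<Sum>a<n. \<Sum>b<n. A $$ (a, i) * (\<Sum>k. M k $$ (a, b)) * A $$ (b, j))"
      unfolding congruence_entry[OF A Q ij] by (simp add: Q_def)
    have term_sums: "(\<lambda>k. A $$ (a, i) * M k $$ (a, b) * A $$ (b, j)) sums
        (A $$ (a, i) * (\<Sum>k. M k $$ (a, b)) * A $$ (b, j))" if "a < n" "b < n" for a b
      using sums_mult2[OF sums_mult[OF summable_sums[OF sm[OF that]], of "A $$ (a, i)"], of "A $$ (b, j)"] .
    have row_sums: "(\<lambda>k. \<Sum>b<n. A $$ (a, i) * M k $$ (a, b) * A $$ (b, j)) sums
        (\<Sum>b<n. A $$ (a, i) * (\<Sum>k. M k $$ (a, b)) * A $$ (b, j))" if "a < n" for a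
      by (rule sums_sum, rule term_sums[OF that]) simp
    have "(\<lambda>k. \<Sum>a<n. \<Sum>b<n. A $$ (a, i) * M k $$ (a, b) * A $$ (b, j)) sums
        (\<Sum>a<n. \<Sum>b<n. A $$ (a, i) * (\<Sum>k. M k $$ (a, b)) * A $$ (b, j))"
      by (rule sums_sum, rule row_sums) simp
    moreover note lhs
    moreover have "(\<Sum>a<n. \<Sum>b<n. A $$ (a, i) * M k $$ (a, b) * A $$ (b, j)) = M (Suc k) $$ (i, j)" for k
    proof -
      have "M (Suc k) = A\<^sup>T * M k * A"
        unfolding M_def by (rule congruence_pow_Suc[OF A G])
      then show ?thesis by (simp only: congruence_entry[OF A M ij])
    qed
    ultimately have "(\<lambda>k. M (Suc k) $$ (i, j)) sums (A\<^sup>T * Q * A) $$ (i, j)" by simp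
    then have "(\<lambda>k. M k $$ (i, j)) sums ((A\<^sup>T * Q * A) $$ (i, j) + M 0 $$ (i, j))"
      by (rule sums_Suc)
    then have "(\<Sum>k. M k $$ (i, j)) = (A\<^sup>T * Q * A) $$ (i, j) + M 0 $$ (i, j)"
      by (rule sums_unique[symmetric])
    moreover have "M 0 = G" using A G by (simp add: M_def)
    ultimately show "(A\<^sup>T * Q * A + C\<^sup>T * C) $$ (i, j) = Q $$ (i, j)"
      using ij A C Q by (simp add: Q_def G_def)
  qed (use A C in \<open>auto simp: Q_def\<close>)
qed

text \<open>The difference \<open>D\<close> of two solutions is fixed by congruence with
  \<open>A\<close>, hence with every power of \<open>A\<close>; by stability these congruences tend
  to 0.\<close>

lemma lyapunov_equation_unique:
  assumes A: "A \<in> carrier_mat n n" and C: "C \<in> carrier_mat m n" and st: "schur_stable A"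
    and Q: "Q \<in> carrier_mat n n" "A\<^sup>T * Q * A + C\<^sup>T * C = Q"
    and R: "R \<in> carrier_mat n n" "A\<^sup>T * R * A + C\<^sup>T * C = R"
  shows "Q = R"
proof -
  define D where "D = Q - R"
  have D: "D \<in> carrier_mat n n" using R by (simp add: D_def minus_carrier_mat)
  have step: "A\<^sup>T * D * A = D"
  proof (intro eq_matI)
    fix i j assume "i < dim_row D" "j < dim_col D"
    then have ij: "i < n" "j < n" using D by auto
    have eq: "(A\<^sup>T * Q * A) $$ (i, j) + (C\<^sup>T * C) $$ (i, j) = Q $$ (i, j)"
      "(A\<^sup>T * R * A) $$ (i, j) + (C\<^sup>T * C) $$ (i, j) = R $$ (i, j)"
      using arg_cong[OF Q(2), of "\<lambda>X. X $$ (i, j)"] arg_cong[OF R(2), of "\<lambda>X. X $$ (i, j)"]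
        A C ij by auto
    have "(A\<^sup>T * D * A) $$ (i, j) = (A\<^sup>T * Q * A) $$ (i, j) - (A\<^sup>T * R * A) $$ (i, j)"
      unfolding congruence_entry[OF A D ij] congruence_entry[OF A Q(1) ij] congruence_entry[OF A R(1) ij]
        sum_subtractf[symmetric]
      using Q R by (intro sum.cong refl) (simp add: D_def left_diff_distrib right_diff_distrib)
    also have "\<dots> = D $$ (i, j)" using eq Q R ij by (simp add: D_def)
    finally show "(A\<^sup>T * D * A) $$ (i, j) = D $$ (i, j)" .
  qed (use A D in auto)
  have iter: "(A ^\<^sub>m k)\<^sup>T * D * A ^\<^sub>m k = D" for k
  proof (induction k)
    case 0
    then show ?case using A D by simp
  next
    case (Suc k)
    then show ?case unfolding congruence_pow_Suc[OF A D] using step by simp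
  qed
  show ?thesis
  proof (intro eq_matI)
    fix i j assume "i < dim_row R" "j < dim_col R"
    then have ij: "i < n" "j < n" using R by auto
    have "(\<lambda>k. D $$ (i, j)) \<longlonglongrightarrow> 0"
      using schur_stable_congruence_tendsto_0[OF A st D ij] unfolding iter .
    then have "D $$ (i, j) = 0" by (simp add: LIMSEQ_const_iff)
    then show "Q $$ (i, j) = R $$ (i, j)" using Q R ij by (simp add: D_def)
  qed (use Q R in auto)
qed

section \<open>The observability Gramian\<close>

text \<open>This is the quadratic form at \<open>v\<close> of the finite-horizon observability
  Gramian, the sum of \<open>(A\<^sup>l)\<^sup>T C\<^sup>T C A\<^sup>l\<close> over
  \<open>l < k\<close>.\<close>

definition obs_gram :: "nat \<Rightarrow> real mat \<Rightarrow> real mat \<Rightarrow> real vec \<Rightarrow> real" where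
  "obs_gram k A C v = (\<Sum>l<k. (C *\<^sub>v (A ^\<^sub>m l *\<^sub>v v)) \<bullet> (C *\<^sub>v (A ^\<^sub>m l *\<^sub>v v)))"

text \<open>Splitting off the first summand moves the rest to the vector \<open>A v\<close>, which
  is where one congruence by \<open>A\<close> evaluates a form; both inductions on the horizon rely
  on this match.\<close>

lemma obs_gram_Suc:
  assumes A: "A \<in> carrier_mat n n" and v: "v \<in> carrier_vec n"
  shows "obs_gram (Suc k) A C v = (C *\<^sub>v v) \<bullet> (C *\<^sub>v v) + obs_gram k A C (A *\<^sub>v v)"
proof -
  have "A ^\<^sub>m Suc l *\<^sub>v v = A ^\<^sub>m l *\<^sub>v (A *\<^sub>v v)" for l
    using A v by (simp add: assoc_mult_mat_vec[where ?n\<^sub>1.0=n and ?n\<^sub>2.0=n and ?n\<^sub>3.0=n])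
  then show ?thesis
    unfolding obs_gram_def sum.lessThan_Suc_shift using A v by simp
qed

text \<open>Unrolling the fixed-point equation \<open>k\<close> times leaves the Gramian plus the
  form of \<open>Q\<close> at \<open>A\<^sup>k v\<close> as remainder.\<close>

lemma lyapunov_obs_gram:
  assumes A: "A \<in> carrier_mat n n" and C: "C \<in> carrier_mat m n"
    and Q: "Q \<in> carrier_mat n n" "A\<^sup>T * Q * A + C\<^sup>T * C = Q" and v: "v \<in> carrier_vec n"
  shows "quad Q v = obs_gram k A C v + quad ((A ^\<^sub>m k)\<^sup>T * Q * A ^\<^sub>m k) v"
  using v
proof (induction k arbitrary: v)
  case 0
  then show ?case using A Q by (simp add: obs_gram_def)
next
  case (Suc k)
  have Av: "A *\<^sub>v v \<in> carrier_vec n" using A Suc.prems by simp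
  have P: "A ^\<^sub>m k \<in> carrier_mat n n" using A by simp
  have "quad Q v = quad (A\<^sup>T * Q * A) v + quad (C\<^sup>T * C) v"
    using quad_add[of "A\<^sup>T * Q * A" n "C\<^sup>T * C" v] A C Q Suc.prems by simp
  also have "\<dots> = quad Q (A *\<^sub>v v) + (C *\<^sub>v v) \<bullet> (C *\<^sub>v v)"
    using quad_congruence[OF A Q(1) Suc.prems] quad_gram[OF C Suc.prems] by simp
  also have "quad Q (A *\<^sub>v v) = obs_gram k A C (A *\<^sub>v v) + quad ((A ^\<^sub>m k)\<^sup>T * Q * A ^\<^sub>m k) (A *\<^sub>v v)"
    by (rule Suc.IH[OF Av])
  also have "quad ((A ^\<^sub>m k)\<^sup>T * Q * A ^\<^sub>m k) (A *\<^sub>v v) = quad ((A ^\<^sub>m Suc k)\<^sup>T * Q * A ^\<^sub>m Suc k) v"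
    unfolding congruence_pow_Suc[OF A Q(1)] using A P Q Suc.prems
    by (intro quad_congruence[symmetric]) auto
  finally show ?case unfolding obs_gram_Suc[OF A Suc.prems] by simp
qed

text \<open>Positivity of \<open>Q\<close> is what this bound will establish, so the remainder
  cannot be dropped by its sign. It tends to 0 by stability instead, and the Gramian increases in
  \<open>k\<close> to \<open>quad Q v\<close>.\<close>

lemma obs_gram_le_lyapunov:
  assumes A: "A \<in> carrier_mat n n" and C: "C \<in> carrier_mat m n" and st: "schur_stable A"
    and Q: "Q \<in> carrier_mat n n" "A\<^sup>T * Q * A + C\<^sup>T * C = Q" and v: "v \<in> carrier_vec n"
  shows "obs_gram k A C v \<le> quad Q v"
proof -
  \<comment> \<open>The limit is spelled as a double sum with zero entries so that it matches the
    form term by term.\<close>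
  have "(\<lambda>k. quad ((A ^\<^sub>m k)\<^sup>T * Q * A ^\<^sub>m k) v) \<longlonglongrightarrow> (\<Sum>i<n. \<Sum>j<n. v $ i * 0 * v $ j)"
  proof -
    have "quad ((A ^\<^sub>m k)\<^sup>T * Q * A ^\<^sub>m k) v =
        (\<Sum>i<n. \<Sum>j<n. v $ i * ((A ^\<^sub>m k)\<^sup>T * Q * A ^\<^sub>m k) $$ (i, j) * v $ j)" for k
      using A Q v by (intro quad_entries) auto
    then show ?thesis
      by (simp only:) (intro tendsto_sum tendsto_mult tendsto_const
          schur_stable_congruence_tendsto_0[OF A st Q(1)], auto)
  qed
  then have "(\<lambda>k. quad Q v - quad ((A ^\<^sub>m k)\<^sup>T * Q * A ^\<^sub>m k) v) \<longlonglongrightarrow> quad Q v - 0"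
    by (intro tendsto_diff tendsto_const) simp
  moreover have "quad Q v - quad ((A ^\<^sub>m k)\<^sup>T * Q * A ^\<^sub>m k) v = obs_gram k A C v" for k
    using lyapunov_obs_gram[OF A C Q v, of k] by simp
  ultimately have "(\<lambda>k. obs_gram k A C v) \<longlonglongrightarrow> quad Q v" by simp
  moreover have "incseq (\<lambda>k. obs_gram k A C v)"
    by (intro incseq_SucI) (simp add: obs_gram_def scalar_prod_self_nonneg)
  ultimately show ?thesis by (intro incseq_le)
qed

text \<open>If the Gramian vanishes at \<open>v\<close>, every summand does, so the observability
  matrix annihilates \<open>v\<close>. That is a linear dependence among its columns, against full
  column rank.\<close>

lemma observable_obs_gram_pos:
  assumes A: "A \<in> carrier_mat n n" and C: "C \<in> carrier_mat m n" and obs: "observable n m A C"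
    and v: "v \<in> carrier_vec n" "v \<noteq> 0\<^sub>v n"
  shows "0 < obs_gram n A C v"
proof (rule ccontr)
  assume "\<not> 0 < obs_gram n A C v"
  moreover have "0 \<le> obs_gram n A C v"
    unfolding obs_gram_def by (intro sum_nonneg scalar_prod_self_nonneg)
  ultimately have "obs_gram n A C v = 0" by simp
  then have 0: "C *\<^sub>v (A ^\<^sub>m l *\<^sub>v v) = 0\<^sub>v m" if "l < n" for l
  proof -
    have "C *\<^sub>v (A ^\<^sub>m l *\<^sub>v v) \<in> carrier_vec m"
      using A C v(1) by (intro mult_mat_vec_carrier[of _ m n] mult_mat_vec_carrier[of _ n n]) auto
    moreover have "(C *\<^sub>v (A ^\<^sub>m l *\<^sub>v v)) \<bullet> (C *\<^sub>v (A ^\<^sub>m l *\<^sub>v v)) = 0"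
      using \<open>obs_gram n A C v = 0\<close> that unfolding obs_gram_def
      by (subst (asm) sum_nonneg_eq_0_iff) (auto simp: scalar_prod_self_nonneg)
    ultimately show ?thesis by (rule scalar_prod_self_eq_0)
  qed
  interpret vec_space "TYPE(real)" "m * n" .
  define W where "W = obs_mat n m A C"
  have W: "W \<in> carrier_mat (m * n) n" by (simp add: W_def obs_mat_def)
  have rank: "rank W = n" using obs by (simp add: observable_def W_def)
  \<comment> \<open>Linear independence is stated for the set of columns, which hides repetitions. A
    repetition would leave fewer than \<open>n\<close> distinct columns and hence a rank below
    \<open>n\<close>.\<close>
  have dist: "distinct (cols W)"
  proof (rule ccontr)
    assume nd: "\<not> distinct (cols W)"
    obtain S where S: "maximal S (\<lambda>T. T \<subseteq> set (cols W) \<and> lin_indpt T)"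
      using maximal_exists[of "(\<lambda>T. T \<subseteq> set (cols W) \<and> lin_indpt T)" "card (set (cols W))" "{}"]
      by (meson List.finite_set card_mono empty_iff empty_subsetI finite_lin_indpt2 rev_finite_subset)
    then have "rank W \<le> card (set (cols W))"
      unfolding rank_card_indpt[OF W S] by (simp add: card_mono maximal_def)
    also have "\<dots> < length (cols W)"
      using nd card_length[of "cols W"] card_distinct[of "cols W"] by linarith
    also have "\<dots> = n" using W by simp
    finally show False using rank by simp
  qed
  have "W *\<^sub>v v = 0\<^sub>v (m * n)"
  proof (intro eq_vecI)
    fix p assume "p < dim_vec (0\<^sub>v (m * n) :: real vec)"
    then have p: "p < m * n" by simp
    then have m: "0 < m" by (cases m) auto
    have l: "p div m < n" using p by (simp add: less_mult_imp_div_less mult.commute)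
    have i: "p mod m < m" using m by simp
    have P: "A ^\<^sub>m (p div m) \<in> carrier_mat n n" using A by simp
    define E where "E = C * A ^\<^sub>m (p div m)"
    have E: "E \<in> carrier_mat m n" using C P by (simp add: E_def)
    have "(W *\<^sub>v v) $ p = (E *\<^sub>v v) $ (p mod m)"
      using p i v E by (simp add: W_def obs_mat_def E_def[symmetric] scalar_prod_def)
    also have "\<dots> = 0"
      using 0[OF l] C P v i unfolding E_def by (simp add: assoc_mult_mat_vec[where ?n\<^sub>1.0=m and ?n\<^sub>2.0=n and ?n\<^sub>3.0=n])
    finally show "(W *\<^sub>v v) $ p = 0\<^sub>v (m * n) $ p" using p by simp
  qed (use W in simp)
  then have "lin_dep (set (cols W))" using lin_depI[OF W v(1) v(2) _ dist] by simp
  then show False using full_rank_lin_indpt[OF W rank dist] by simp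
qed

lemma ex1_lyapunov_solution:
  assumes A: "A \<in> carrier_mat n n" and C: "C \<in> carrier_mat m n" and st: "schur_stable A"
    and obs: "observable n m A C"
  shows "\<exists>!Q. lyapunov_solution n A C Q"
proof -
  obtain Q where Q: "Q \<in> carrier_mat n n" "Q\<^sup>T = Q" "A\<^sup>T * Q * A + C\<^sup>T * C = Q"
    using lyapunov_equation_solvable[OF A C st] .
  have "0 < quad Q v" if "v \<in> carrier_vec n" "v \<noteq> 0\<^sub>v n" for v
    using observable_obs_gram_pos[OF A C obs that] obs_gram_le_lyapunov[OF A C st Q(1,3) that(1), of n]
    by linarith
  then have "lyapunov_solution n A C Q"
    using Q lyapunov_eq_iff[OF A C Q(1)] by (simp add: lyapunov_solution_def pos_def_def quad_def)
  moreover have "R = Q" if "lyapunov_solution n A C R" for R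
    using that lyapunov_equation_unique[OF A C st _ _ Q(1,3), of R] lyapunov_eq_iff[OF A C, of R]
    by (simp add: lyapunov_solution_def pos_def_def)
  ultimately show ?thesis by blast
qed

section \<open>Hilbert distance to a positive definite matrix\<close>

lemma transpose_smult: "(a \<cdot>\<^sub>m X)\<^sup>T = a \<cdot>\<^sub>m X\<^sup>T"
  by (intro eq_matI) auto

lemma pos_def_quad_nonneg:
  assumes "pos_def n Q" "v \<in> carrier_vec n"
  shows "0 \<le> quad Q v"
  using psd_quad_nonneg[OF pos_def_imp_psd[OF assms(1)] assms(2)] .

lemma pos_def_quad_pos:
  assumes "pos_def n Q" "v \<in> carrier_vec n" "v \<noteq> 0\<^sub>v n"
  shows "0 < quad Q v"
  using assms by (simp add: pos_def_def quad_def)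

lemma pos_def_quad_unit_vec_pos:
  assumes "pos_def n Q" "i < n"
  shows "0 < quad Q (unit_vec n i)"
  using assms by (intro pos_def_quad_pos) auto

lemma pos_def_trace_pos:
  assumes Q: "pos_def n Q" and n: "0 < n"
  shows "0 < mat_trace Q"
proof -
  have "Q \<in> carrier_mat n n" using Q by (simp add: pos_def_def)
  then show ?thesis
    using pos_def_quad_unit_vec_pos[OF Q] n by (simp add: mat_trace_eq_sum_quad) (intro sum_pos, auto)
qed

text \<open>The trace bounds all entries of \<open>Y\<close>, and coercivity of \<open>Q\<close>
  converts \<open>v \<bullet> v\<close> into \<open>quad Q v\<close>. One \<open>K\<close> serves
  all \<open>Y\<close>; taking the maximum with 1 gives \<open>1 \<le> K\<close>, which the
  contraction estimate uses.\<close>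

lemma psd_le_trace_pos_def:
  assumes Q: "pos_def n Q" and n: "0 < n"
  shows "\<exists>K\<ge>1. \<forall>Y\<in>psd n. \<forall>v\<in>carrier_vec n. quad Y v \<le> K * (mat_trace Y / mat_trace Q) * quad Q v"
proof -
  obtain e where e: "e > 0" "\<And>v. v \<in> carrier_vec n \<Longrightarrow> e * (v \<bullet> v) \<le> quad Q v"
    using pos_def_coercive[OF Q] by blast
  define K where "K = max 1 (real (n * n) * mat_trace Q / e)"
  have t: "0 < mat_trace Q" by (rule pos_def_trace_pos[OF Q n])
  have "quad Y v \<le> K * (mat_trace Y / mat_trace Q) * quad Q v"
    if Y: "Y \<in> psd n" and v: "v \<in> carrier_vec n" for Y v
  proof -
    have tY: "0 \<le> mat_trace Y" by (rule psd_trace_nonneg[OF Y])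
    have "quad Y v \<le> real (n * n) * mat_trace Y * (v \<bullet> v)"
      by (rule psd_quad_le_trace[OF Y v])
    also have "\<dots> \<le> real (n * n) * mat_trace Y * (quad Q v / e)"
      using e v tY by (intro mult_left_mono mult_nonneg_nonneg) (auto simp: field_simps)
    also have "\<dots> = real (n * n) * mat_trace Q / e * (mat_trace Y / mat_trace Q) * quad Q v"
      using t e(1) by (simp add: field_simps)
    also have "\<dots> \<le> K * (mat_trace Y / mat_trace Q) * quad Q v"
      using t tY pos_def_quad_nonneg[OF Q v] by (intro mult_right_mono) (auto simp: K_def)
    finally show ?thesis .
  qed
  then show ?thesis by (intro exI[of _ K]) (auto simp: K_def)
qed

lemma loewner_le_smult_iff:
  assumes X: "X \<in> carrier_mat n n" "X\<^sup>T = X" and Q: "Q \<in> carrier_mat n n" "Q\<^sup>T = Q"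
  shows "loewner_le n X (l \<cdot>\<^sub>m Q) \<longleftrightarrow> (\<forall>v\<in>carrier_vec n. quad X v \<le> l * quad Q v)"
    and "loewner_le n (l \<cdot>\<^sub>m Q) X \<longleftrightarrow> (\<forall>v\<in>carrier_vec n. l * quad Q v \<le> quad X v)"
proof -
  have lQ: "l \<cdot>\<^sub>m Q \<in> carrier_mat n n" "(l \<cdot>\<^sub>m Q)\<^sup>T = l \<cdot>\<^sub>m Q"
    using Q by (auto simp: transpose_smult)
  show "loewner_le n X (l \<cdot>\<^sub>m Q) \<longleftrightarrow> (\<forall>v\<in>carrier_vec n. quad X v \<le> l * quad Q v)"
    using loewner_le_iff[OF X lQ] Q by (simp add: quad_smult)
  show "loewner_le n (l \<cdot>\<^sub>m Q) X \<longleftrightarrow> (\<forall>v\<in>carrier_vec n. l * quad Q v \<le> quad X v)"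
    using loewner_le_iff[OF lQ X] Q by (simp add: quad_smult)
qed

lemma hilbert_dist_le:
  assumes Q: "pos_def n Q" and n: "0 < n" and X: "X \<in> carrier_mat n n" "X\<^sup>T = X"
    and ab: "0 < a" "a \<le> b"
    and lo: "\<And>v. v \<in> carrier_vec n \<Longrightarrow> a * quad Q v \<le> quad X v"
    and up: "\<And>v. v \<in> carrier_vec n \<Longrightarrow> quad X v \<le> b * quad Q v"
  shows "hilbert_dist n X Q \<le> ereal (ln (b / a))"
proof -
  have Q': "Q \<in> carrier_mat n n" "Q\<^sup>T = Q" using Q by (auto simp: pos_def_def)
  \<comment> \<open>At this single test vector the form of \<open>Q\<close> is positive. Comparing
    there shows that factors admissible for \<open>hilbert_M\<close> are at least \<open>a\<close>
    and those for \<open>hilbert_m\<close> at most \<open>b\<close>, so both extrema are reals in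
    \<open>[a, b]\<close>.\<close>
  define e where "e = (unit_vec n 0 :: real vec)"
  have e: "e \<in> carrier_vec n" "0 < quad Q e"
    using pos_def_quad_unit_vec_pos[OF Q n] by (auto simp: e_def)
  note leM = loewner_le_smult_iff(1)[OF X Q'] and lem = loewner_le_smult_iff(2)[OF X Q']
  have "hilbert_M n X Q \<le> ereal b"
    unfolding hilbert_M_def using up by (intro Inf_lower) (auto simp: leM)
  moreover have "ereal a \<le> hilbert_M n X Q"
    unfolding hilbert_M_def
  proof (intro Inf_greatest)
    fix z assume "z \<in> {ereal l |l. loewner_le n X (l \<cdot>\<^sub>m Q)}"
    then obtain l where l: "z = ereal l" "quad X e \<le> l * quad Q e" using e by (auto simp: leM)
    then have "a * quad Q e \<le> l * quad Q e" using lo[OF e(1)] by linarith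
    then show "ereal a \<le> z" using l(1) e(2) by simp
  qed
  moreover have "ereal a \<le> hilbert_m n X Q"
    unfolding hilbert_m_def using lo by (intro Sup_upper) (auto simp: lem)
  moreover have "hilbert_m n X Q \<le> ereal b"
    unfolding hilbert_m_def
  proof (intro Sup_least)
    fix z assume "z \<in> {ereal l |l. loewner_le n (l \<cdot>\<^sub>m Q) X}"
    then obtain l where l: "z = ereal l" "l * quad Q e \<le> quad X e" using e by (auto simp: lem)
    then have "l * quad Q e \<le> b * quad Q e" using up[OF e(1)] by linarith
    then show "z \<le> ereal b" using l(1) e(2) by simp
  qed
  ultimately obtain s t where st: "hilbert_M n X Q = ereal s" "hilbert_m n X Q = ereal t"
    "a \<le> s" "s \<le> b" "a \<le> t" "t \<le> b"
    by (cases "hilbert_M n X Q"; cases "hilbert_m n X Q") auto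
  have "s / t \<le> b / a" using st ab by (intro frac_le) auto
  then have "ln (s / t) \<le> ln (b / a)" using st ab by (intro ln_mono) auto
  then show ?thesis using st ab by (simp add: hilbert_dist_def)
qed

text \<open>The converse direction: a finite distance means real, positive extrema, and these are
  attained, because at each fixed \<open>v\<close> with positive \<open>quad Q v\<close>
  admissibility is a bound by the ratio \<open>quad X v / quad Q v\<close>.\<close>

lemma hilbert_dist_finite_bounds:
  assumes Q: "pos_def n Q" and n: "0 < n" and X: "X \<in> psd n"
    and fin: "hilbert_dist n X Q \<noteq> \<infinity>"
  obtains a b where "0 < a" "a \<le> b" "hilbert_dist n X Q = ereal (ln (b / a))"
    "\<And>v. v \<in> carrier_vec n \<Longrightarrow> a * quad Q v \<le> quad X v"
    "\<And>v. v \<in> carrier_vec n \<Longrightarrow> quad X v \<le> b * quad Q v"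
proof -
  have X': "X \<in> carrier_mat n n" "X\<^sup>T = X" using X by (auto simp: psd_def)
  have Q': "Q \<in> carrier_mat n n" "Q\<^sup>T = Q" using Q by (auto simp: pos_def_def)
  define e where "e = (unit_vec n 0 :: real vec)"
  have e: "e \<in> carrier_vec n" "0 < quad Q e"
    using pos_def_quad_unit_vec_pos[OF Q n] by (auto simp: e_def)
  note leM = loewner_le_smult_iff(1)[OF X' Q'] and lem = loewner_le_smult_iff(2)[OF X' Q']
  obtain K where K: "\<And>v. v \<in> carrier_vec n \<Longrightarrow> quad X v \<le> K * quad Q v"
    using psd_le_trace_pos_def[OF Q n] X by blast
  have M: "hilbert_M n X Q \<noteq> \<infinity>" and m: "hilbert_m n X Q \<noteq> 0"
    using fin by (auto simp: hilbert_dist_def)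
  \<comment> \<open>The factor 0 is admissible since \<open>X\<close> is positive
    semidefinite.\<close>
  have "0 \<le> hilbert_m n X Q"
    unfolding hilbert_m_def using psd_quad_nonneg[OF X]
    by (intro Sup_upper) (auto simp: lem zero_ereal_def)
  moreover have le: "u \<le> l" if "loewner_le n (u \<cdot>\<^sub>m Q) X" "loewner_le n X (l \<cdot>\<^sub>m Q)" for u l
  proof -
    have "u * quad Q e \<le> l * quad Q e" using that e(1) unfolding leM lem by fastforce
    then show ?thesis using e(2) by simp
  qed
  have mM: "hilbert_m n X Q \<le> hilbert_M n X Q"
    unfolding hilbert_M_def hilbert_m_def by (intro Sup_least Inf_greatest) (auto intro: le)
  ultimately obtain a b where ab: "hilbert_m n X Q = ereal a" "hilbert_M n X Q = ereal b"
    "0 < a" "a \<le> b"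
    using M m by (cases "hilbert_M n X Q"; cases "hilbert_m n X Q") (auto simp: less_le zero_ereal_def)
  have zero: "v = 0\<^sub>v n" if "v \<in> carrier_vec n" "\<not> 0 < quad Q v" for v
    using pos_def_quad_pos[OF Q] that by blast
  show ?thesis
  proof (rule that[OF ab(3,4)])
    show "hilbert_dist n X Q = ereal (ln (b / a))"
      using ab by (simp add: hilbert_dist_def)
    fix v :: "real vec" assume v: "v \<in> carrier_vec n"
    show "a * quad Q v \<le> quad X v"
    proof (cases "0 < quad Q v")
      case True
      have "hilbert_m n X Q \<le> ereal (quad X v / quad Q v)"
        unfolding hilbert_m_def using True v by (intro Sup_least) (auto simp: lem field_simps)
      then show ?thesis using True ab(1) by (simp add: field_simps)
    next
      case False
      then have "quad Q v = 0" using pos_def_quad_nonneg[OF Q v] by simp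
      then show ?thesis using psd_quad_nonneg[OF X v] by simp
    qed
    show "quad X v \<le> b * quad Q v"
    proof (cases "0 < quad Q v")
      case True
      have "ereal (quad X v / quad Q v) \<le> hilbert_M n X Q"
        unfolding hilbert_M_def using True v by (intro Inf_greatest) (auto simp: leM field_simps)
      then show ?thesis using True ab(2) by (simp add: field_simps)
    next
      case False
      then have "quad Q v = 0" using pos_def_quad_nonneg[OF Q v] by simp
      \<comment> \<open>Where the form of \<open>Q\<close> vanishes, domination by \<open>K\<close>
        makes that of \<open>X\<close> nonpositive.\<close>
      then show ?thesis using K[OF v] by simp
    qed
  qed
qed

section \<open>Contraction of the iteration\<close>

text \<open>The ratio on the left decreases as \<open>l\<close> grows, so its worst case is
  \<open>l = b / K\<close>. There it equals \<open>b / z\<close> with \<open>z\<close> the mean of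
  \<open>a\<close> and \<open>b\<close> of weights \<open>1 - \<theta>\<close> and
  \<open>\<theta>\<close>, and concavity of the logarithm bounds \<open>ln z\<close> from
  below.\<close>

lemma ln_ratio_contraction:
  fixes a b c l K :: real
  assumes ab: "0 < a" "a \<le> b" and l: "b \<le> K * l" and c: "0 < c" "c < 1" and K: "1 \<le> K"
  defines "\<theta> \<equiv> (c / K) / (1 - c + c / K)"
  shows "ln (((1 - c) * b + c * l) / ((1 - c) * a + c * l)) \<le> (1 - \<theta>) * ln (b / a)"
proof -
  define D where "D = 1 - c + c / K"
  have u: "0 < c / K" using c K by simp
  then have D: "0 < D" "c / K < D" using c by (simp_all add: D_def)
  have \<theta>: "0 < \<theta>" "\<theta> < 1"
    unfolding \<theta>_def D_def[symmetric] using u D by (simp_all only: divide_pos_pos divide_less_eq_1_pos)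
  define z where "z = (1 - \<theta>) * a + \<theta> * b"
  have z: "0 < z" using \<theta> ab by (simp add: z_def add_pos_pos)
  have Dz: "D * z = (1 - c) * a + c * b / K"
  proof -
    have "D * \<theta> = c / K" "D * (1 - \<theta>) = 1 - c"
      using D by (auto simp: \<theta>_def D_def[symmetric] right_diff_distrib) (simp add: D_def)
    moreover have "D * z = (D * (1 - \<theta>)) * a + (D * \<theta>) * b"
      by (simp add: z_def distrib_left mult.assoc)
    ultimately show ?thesis by simp
  qed
  have s: "c * b / K \<le> c * l"
    using l c K by (simp add: field_simps)
  have l0: "0 < l" using l ab K by (smt (verit) mult_nonneg_nonpos)
  have pos: "0 < (1 - c) * a + c * l" "0 < (1 - c) * b + c * l"
    using ab c l0 by (auto intro!: add_pos_pos mult_pos_pos)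
  have "((1 - c) * b + c * l) * (D * z) \<le> (D * b) * ((1 - c) * a + c * l)"
  proof -
    have Db: "D * b = (1 - c) * b + c * b / K" by (simp add: D_def distrib_right)
    \<comment> \<open>After cross-multiplication the gap factors into three nonnegative terms; the
      last one is the comparison of \<open>l\<close> with \<open>b / K\<close>.\<close>
    have "(D * b) * ((1 - c) * a + c * l) - ((1 - c) * b + c * l) * (D * z)
        = (1 - c) * (b - a) * (c * l - c * b / K)"
      unfolding Dz Db by (simp only: ring_distribs) (simp add: algebra_simps)
    moreover have "0 \<le> (1 - c) * (b - a) * (c * l - c * b / K)"
      using ab c s by (intro mult_nonneg_nonneg) auto
    ultimately show ?thesis by linarith
  qed
  then have "((1 - c) * b + c * l) * z \<le> b * ((1 - c) * a + c * l)"
    using D by (simp add: mult.left_commute[of _ D] mult.assoc)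
  then have "((1 - c) * b + c * l) / ((1 - c) * a + c * l) \<le> b / z"
    using pos z by (simp add: divide_simps mult.commute)
  then have "ln (((1 - c) * b + c * l) / ((1 - c) * a + c * l)) \<le> ln (b / z)"
    using pos by (intro ln_mono) auto
  also have "\<dots> \<le> (1 - \<theta>) * ln (b / a)"
  proof -
    \<comment> \<open>The bound \<open>ln x \<le> x - 1\<close> at \<open>a / z\<close> and
      \<open>b / z\<close>, averaged with the weights defining \<open>z\<close>, has right-hand side
      0 and yields the concavity inequality.\<close>
    have "ln (a / z) \<le> a / z - 1" "ln (b / z) \<le> b / z - 1"
      using ab z by (auto intro!: ln_le_minus_one)
    then have "(1 - \<theta>) * ln (a / z) + \<theta> * ln (b / z) \<le> (1 - \<theta>) * (a / z - 1) + \<theta> * (b / z - 1)"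
      using \<theta> by (intro add_mono mult_left_mono) auto
    also have "\<dots> = ((1 - \<theta>) * a + \<theta> * b) / z - 1"
      by (simp add: algebra_simps add_divide_distrib diff_divide_distrib)
    also have "\<dots> = 0" using z by (simp add: z_def[symmetric])
    finally have le: "(1 - \<theta>) * ln (a / z) + \<theta> * ln (b / z) \<le> 0" .
    have eqs: "ln (a / z) = ln a - ln z" "ln (b / z) = ln b - ln z" "ln (b / a) = ln b - ln a"
      using ab z by (auto simp: ln_div)
    show ?thesis using le unfolding eqs by (simp add: algebra_simps)
  qed
  finally show ?thesis .
qed

section \<open>The linear map fixing \<open>Q\<close> and its order properties\<close>

locale lyapunov_iteration =
  fixes n m :: nat and A C Q :: "real mat"
  assumes n_pos: "0 < n"
    and A: "A \<in> carrier_mat n n" and C: "C \<in> carrier_mat m n"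
    and Q: "pos_def n Q" and Q_eq: "A\<^sup>T * Q * A + C\<^sup>T * C = Q"
    and obs: "\<And>v. v \<in> carrier_vec n \<Longrightarrow> v \<noteq> 0\<^sub>v n \<Longrightarrow> 0 < obs_gram n A C v"
begin

definition \<tau> :: "real mat \<Rightarrow> real" where
  "\<tau> X = mat_trace X / mat_trace Q"

definition step :: "real mat \<Rightarrow> real mat" where
  "step X = A\<^sup>T * X * A + \<tau> X \<cdot>\<^sub>m (C\<^sup>T * C)"

lemma Q_carrier: "Q \<in> carrier_mat n n" and Q_sym: "Q\<^sup>T = Q"
  using Q by (auto simp: pos_def_def)

lemma trace_Q_pos: "0 < mat_trace Q"
  by (rule pos_def_trace_pos[OF Q n_pos])

lemma CTC_carrier: "C\<^sup>T * C \<in> carrier_mat n n"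
  using C by simp

lemma CTC_psd: "C\<^sup>T * C \<in> psd n"
proof -
  have "(C\<^sup>T * C)\<^sup>T = C\<^sup>T * C" using C by (simp add: transpose_mult[of _ n m _ n])
  moreover have "0 \<le> quad (C\<^sup>T * C) v" if "v \<in> carrier_vec n" for v
    unfolding quad_gram[OF C that] by (rule scalar_prod_self_nonneg)
  ultimately show ?thesis using CTC_carrier unfolding psd_def quad_def by blast
qed

lemma \<tau>_Q: "\<tau> Q = 1"
  using trace_Q_pos by (simp add: \<tau>_def)

lemma \<tau>_nonneg: "X \<in> psd n \<Longrightarrow> 0 \<le> \<tau> X"
  using trace_Q_pos psd_trace_nonneg by (simp add: \<tau>_def)

lemma \<tau>_diff:
  assumes "X \<in> carrier_mat n n" "Y \<in> carrier_mat n n"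
  shows "\<tau> (X - Y) = \<tau> X - \<tau> Y"
  using assms by (simp add: \<tau>_def mat_trace_def sum_subtractf diff_divide_distrib)

lemma \<tau>_smult:
  assumes "X \<in> carrier_mat n n"
  shows "\<tau> (a \<cdot>\<^sub>m X) = a * \<tau> X"
  using assms by (simp add: \<tau>_def mat_trace_def sum_distrib_left)

lemma \<tau>_mono:
  assumes "X \<in> carrier_mat n n" "Y \<in> carrier_mat n n"
    and "\<And>v. v \<in> carrier_vec n \<Longrightarrow> quad X v \<le> quad Y v"
  shows "\<tau> X \<le> \<tau> Y"
  unfolding \<tau>_def using assms trace_Q_pos
  by (intro divide_right_mono) (auto simp: mat_trace_eq_sum_quad intro!: sum_mono)

lemma step_Q: "step Q = Q"
proof -
  have "1 \<cdot>\<^sub>m (C\<^sup>T * C) = C\<^sup>T * C" by (intro eq_matI) auto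
  then show ?thesis unfolding step_def \<tau>_Q using Q_eq by simp
qed

lemma step_carrier: "X \<in> carrier_mat n n \<Longrightarrow> step X \<in> carrier_mat n n"
  using A CTC_carrier by (simp add: step_def)

lemma step_sym:
  assumes X: "X \<in> carrier_mat n n" "X\<^sup>T = X"
  shows "(step X)\<^sup>T = step X"
proof -
  define P where "P = A\<^sup>T * X * A"
  have P: "P \<in> carrier_mat n n" using A X by (simp add: P_def)
  have "P\<^sup>T = P" unfolding P_def by (rule congruence_symmetric[OF A X])
  moreover have "(C\<^sup>T * C)\<^sup>T = C\<^sup>T * C" using CTC_psd by (simp add: psd_def)
  ultimately show ?thesis
    using P CTC_carrier unfolding step_def P_def[symmetric]
    by (simp add: transpose_add[of _ n n] transpose_smult)
qed

lemma quad_step: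
  assumes X: "X \<in> carrier_mat n n" and v: "v \<in> carrier_vec n"
  shows "quad (step X) v = quad X (A *\<^sub>v v) + \<tau> X * ((C *\<^sub>v v) \<bullet> (C *\<^sub>v v))"
proof -
  have "quad (step X) v = quad (A\<^sup>T * X * A) v + quad (\<tau> X \<cdot>\<^sub>m (C\<^sup>T * C)) v"
    unfolding step_def using A X v CTC_carrier by (intro quad_add[of _ n]) auto
  also have "\<dots> = quad X (A *\<^sub>v v) + \<tau> X * ((C *\<^sub>v v) \<bullet> (C *\<^sub>v v))"
    unfolding quad_congruence[OF A X v] quad_smult[OF CTC_carrier v] quad_gram[OF C v] ..
  finally show ?thesis .
qed

lemma step_psd:
  assumes X: "X \<in> psd n"
  shows "step X \<in> psd n"
proof -
  have X': "X \<in> carrier_mat n n" "X\<^sup>T = X" using X by (auto simp: psd_def)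
  have "0 \<le> quad (step X) v" if "v \<in> carrier_vec n" for v
    using A that psd_quad_nonneg[OF X, of "A *\<^sub>v v"] \<tau>_nonneg[OF X]
    by (simp add: quad_step[OF X'(1) that] scalar_prod_self_nonneg)
  then show ?thesis
    using step_carrier[OF X'(1)] step_sym[OF X'] by (simp add: psd_def quad_def)
qed

lemma step_entry:
  assumes "X \<in> carrier_mat n n" "i < n" "j < n"
  shows "step X $$ (i, j) =
    (\<Sum>a<n. \<Sum>b<n. A $$ (a, i) * X $$ (a, b) * A $$ (b, j)) + \<tau> X * (C\<^sup>T * C) $$ (i, j)"
proof -
  have "step X $$ (i, j) = (A\<^sup>T * X * A) $$ (i, j) + \<tau> X * (C\<^sup>T * C) $$ (i, j)"
    unfolding step_def using assms A C by simp
  then show ?thesis unfolding congruence_entry[OF A assms] .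
qed

lemma step_diff:
  assumes X: "X \<in> carrier_mat n n" and Y: "Y \<in> carrier_mat n n"
  shows "step (X - Y) = step X - step Y"
proof (intro eq_matI)
  have XY: "X - Y \<in> carrier_mat n n" using Y by (rule minus_carrier_mat)
  fix i j assume "i < dim_row (step X - step Y)" "j < dim_col (step X - step Y)"
  then have ij: "i < n" "j < n" using step_carrier[OF Y] by auto
  have "(\<Sum>a<n. \<Sum>b<n. A $$ (a, i) * (X - Y) $$ (a, b) * A $$ (b, j)) =
      (\<Sum>a<n. \<Sum>b<n. A $$ (a, i) * X $$ (a, b) * A $$ (b, j)) -
      (\<Sum>a<n. \<Sum>b<n. A $$ (a, i) * Y $$ (a, b) * A $$ (b, j))"
    unfolding sum_subtractf[symmetric] using X Y
    by (intro sum.cong refl) (simp add: left_diff_distrib right_diff_distrib)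
  then show "step (X - Y) $$ (i, j) = (step X - step Y) $$ (i, j)"
    using step_carrier[OF X] step_carrier[OF Y] ij
    by (simp add: step_entry[OF XY ij] step_entry[OF X ij] step_entry[OF Y ij] \<tau>_diff[OF X Y] left_diff_distrib)
qed (use step_carrier[OF X] step_carrier[OF Y] step_carrier[OF minus_carrier_mat[OF Y]] in auto)

lemma step_smult:
  assumes X: "X \<in> carrier_mat n n"
  shows "step (a \<cdot>\<^sub>m X) = a \<cdot>\<^sub>m step X"
proof (intro eq_matI)
  have aX: "a \<cdot>\<^sub>m X \<in> carrier_mat n n" using X by simp
  fix i j assume "i < dim_row (a \<cdot>\<^sub>m step X)" "j < dim_col (a \<cdot>\<^sub>m step X)"
  then have ij: "i < n" "j < n" using step_carrier[OF X] by auto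
  have "(\<Sum>k<n. \<Sum>b<n. A $$ (k, i) * (a \<cdot>\<^sub>m X) $$ (k, b) * A $$ (b, j)) =
      a * (\<Sum>k<n. \<Sum>b<n. A $$ (k, i) * X $$ (k, b) * A $$ (b, j))"
    unfolding sum_distrib_left using X by (intro sum.cong refl) simp
  then show "step (a \<cdot>\<^sub>m X) $$ (i, j) = (a \<cdot>\<^sub>m step X) $$ (i, j)"
    using step_carrier[OF X] ij
    by (simp add: step_entry[OF aX ij] step_entry[OF X ij] \<tau>_smult[OF X] distrib_left)
qed (use step_carrier[OF X] step_carrier[of "a \<cdot>\<^sub>m X"] X in auto)

section \<open>Iterates of the map and their uniform positivity\<close>

lemma funpow_step_carrier: "X \<in> carrier_mat n n \<Longrightarrow> (step ^^ k) X \<in> carrier_mat n n"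
  by (induction k) (auto intro: step_carrier)

lemma funpow_step_psd: "X \<in> psd n \<Longrightarrow> (step ^^ k) X \<in> psd n"
  by (induction k) (auto intro: step_psd)

lemma funpow_step_smult_Q: "(step ^^ k) (a \<cdot>\<^sub>m Q) = a \<cdot>\<^sub>m Q"
  by (induction k) (auto simp: step_smult[OF Q_carrier] step_Q)

lemma funpow_step_diff:
  assumes "X \<in> carrier_mat n n" "Y \<in> carrier_mat n n"
  shows "(step ^^ k) (X - Y) = (step ^^ k) X - (step ^^ k) Y"
  using assms by (induction k) (auto simp: step_diff funpow_step_carrier)

text \<open>A zero trace would make the form of \<open>C\<^sup>T * C\<close> vanish, and with it
  every summand of the Gramian, which is positive at the first unit vector.\<close>

lemma trace_CTC_pos: "0 < mat_trace (C\<^sup>T * C)"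
proof (rule ccontr)
  assume "\<not> 0 < mat_trace (C\<^sup>T * C)"
  then have 0: "mat_trace (C\<^sup>T * C) = 0" using psd_trace_nonneg[OF CTC_psd] by simp
  have zero: "(C *\<^sub>v w) \<bullet> (C *\<^sub>v w) = 0" if "w \<in> carrier_vec n" for w
    using psd_quad_le_trace[OF CTC_psd that] scalar_prod_self_nonneg[of "C *\<^sub>v w"]
    unfolding 0 quad_gram[OF C that] by simp
  have "obs_gram n A C (unit_vec n 0) = 0"
    unfolding obs_gram_def using A
    by (intro sum.neutral ballI zero mult_mat_vec_carrier[of _ n n]) auto
  moreover have "unit_vec n 0 \<noteq> (0\<^sub>v n :: real vec)" using n_pos by simp
  ultimately show False using obs[of "unit_vec n 0"] by simp
qed

lemma \<tau>_step_ge: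
  assumes X: "X \<in> psd n"
  shows "\<tau> (C\<^sup>T * C) * \<tau> X \<le> \<tau> (step X)"
proof -
  have X': "X \<in> carrier_mat n n" using X by (simp add: psd_def)
  have "\<tau> (\<tau> X \<cdot>\<^sub>m (C\<^sup>T * C)) \<le> \<tau> (step X)"
  proof (rule \<tau>_mono)
    fix v :: "real vec" assume v: "v \<in> carrier_vec n"
    show "quad (\<tau> X \<cdot>\<^sub>m (C\<^sup>T * C)) v \<le> quad (step X) v"
      using psd_quad_nonneg[OF X, of "A *\<^sub>v v"] A v
      unfolding quad_smult[OF CTC_carrier v] quad_gram[OF C v] quad_step[OF X' v] by simp
  qed (use step_carrier[OF X'] CTC_carrier in auto)
  then show ?thesis unfolding \<tau>_smult[OF CTC_carrier] by (simp add: mult.commute)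
qed

text \<open>Each application of \<open>step\<close> adds a Gramian summand weighted by the current
  normalised trace, and that trace shrinks by no more than the factor \<open>d\<close> per
  step.\<close>

lemma funpow_step_quad_ge:
  "\<exists>g>0. \<forall>k\<le>n. \<forall>X\<in>psd n. \<forall>v\<in>carrier_vec n. g * \<tau> X * obs_gram k A C v \<le> quad ((step ^^ k) X) v"
proof -
  \<comment> \<open>Capping at 1 makes the powers of \<open>d\<close> nonincreasing, so
    \<open>d ^ n\<close> is a valid weight for all steps up to \<open>n\<close>.\<close>
  define d where "d = min 1 (\<tau> (C\<^sup>T * C))"
  have d: "0 < d" "d \<le> 1" "d \<le> \<tau> (C\<^sup>T * C)"
    using trace_CTC_pos trace_Q_pos by (auto simp: d_def \<tau>_def)
  have pow: "d ^ k * \<tau> X \<le> \<tau> ((step ^^ k) X)" if X: "X \<in> psd n" for X k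
  proof (induction k)
    case (Suc k)
    have "d ^ Suc k * \<tau> X \<le> d * \<tau> ((step ^^ k) X)"
      using Suc d by (simp add: mult.assoc)
    also have "\<dots> \<le> \<tau> (C\<^sup>T * C) * \<tau> ((step ^^ k) X)"
      using d \<tau>_nonneg[OF funpow_step_psd[OF X]] by (intro mult_right_mono)
    also have "\<dots> \<le> \<tau> ((step ^^ Suc k) X)"
      using \<tau>_step_ge[OF funpow_step_psd[OF X]] by simp
    finally show ?case .
  qed simp
  have "d ^ n * \<tau> X * obs_gram k A C v \<le> quad ((step ^^ k) X) v"
    if "k \<le> n" and X: "X \<in> psd n" and "v \<in> carrier_vec n" for k X v
    using that(1,3)
  proof (induction k arbitrary: v)
    case 0
    then show ?case using psd_quad_nonneg[OF X] by (simp add: obs_gram_def)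
  next
    case (Suc k)
    have Xk: "(step ^^ k) X \<in> carrier_mat n n"
      using X by (auto simp: psd_def intro: funpow_step_carrier)
    have Av: "A *\<^sub>v v \<in> carrier_vec n" using A Suc.prems by simp
    have "d ^ n \<le> d ^ k" using d Suc.prems by (intro power_decreasing) auto
    then have "d ^ n * \<tau> X \<le> d ^ k * \<tau> X" using \<tau>_nonneg[OF X] by (rule mult_right_mono)
    also have "\<dots> \<le> \<tau> ((step ^^ k) X)" by (rule pow[OF X])
    finally have "d ^ n * \<tau> X * ((C *\<^sub>v v) \<bullet> (C *\<^sub>v v)) \<le> \<tau> ((step ^^ k) X) * ((C *\<^sub>v v) \<bullet> (C *\<^sub>v v))"
      by (rule mult_right_mono) (rule scalar_prod_self_nonneg)
    moreover have "d ^ n * \<tau> X * obs_gram k A C (A *\<^sub>v v) \<le> quad ((step ^^ k) X) (A *\<^sub>v v)"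
      using Suc.IH[OF _ Av] Suc.prems by simp
    moreover have "quad ((step ^^ Suc k) X) v =
        quad ((step ^^ k) X) (A *\<^sub>v v) + \<tau> ((step ^^ k) X) * ((C *\<^sub>v v) \<bullet> (C *\<^sub>v v))"
      using quad_step[OF Xk Suc.prems(2)] by simp
    ultimately show ?case
      unfolding obs_gram_Suc[OF A Suc.prems(2)] by (simp add: distrib_left)
  qed
  then show ?thesis using d by (intro exI[of _ "d ^ n"]) auto
qed

text \<open>The matrix of the form \<open>obs_gram n A C\<close> is \<open>Q - (A\<^sup>n)\<^sup>T Q A\<^sup>n\<close>.\<close>

lemma obs_gram_ge_Q: "\<exists>e>0. \<forall>v\<in>carrier_vec n. e * quad Q v \<le> obs_gram n A C v"
proof -
  define P where "P = A ^\<^sub>m n"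
  have P: "P \<in> carrier_mat n n" using A by (simp add: P_def)
  define R where "R = P\<^sup>T * Q * P"
  have R: "R \<in> carrier_mat n n" using P Q_carrier by (simp add: R_def)
  have RT: "R\<^sup>T = R" unfolding R_def by (rule congruence_symmetric[OF P Q_carrier Q_sym])
  have gram: "quad (Q - R) v = obs_gram n A C v" if "v \<in> carrier_vec n" for v
    using lyapunov_obs_gram[OF A C Q_carrier Q_eq that, of n] quad_minus[OF Q_carrier R that]
    by (simp add: R_def P_def)
  have "(Q - R)\<^sup>T = Q - R" using transpose_minus[OF Q_carrier R] Q_sym RT by simp
  then have "pos_def n (Q - R)"
    using gram obs R unfolding pos_def_def quad_def by (auto intro: minus_carrier_mat)
  then obtain e where e: "e > 0" "\<And>v. v \<in> carrier_vec n \<Longrightarrow> e * (v \<bullet> v) \<le> quad (Q - R) v"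
    using pos_def_coercive by blast
  obtain K where K: "K > 0" "\<And>v. v \<in> carrier_vec n \<Longrightarrow> quad Q v \<le> K * (v \<bullet> v)"
    using quad_bounded[OF Q_carrier] by blast
  \<comment> \<open>Both forms are compared with \<open>v \<bullet> v\<close>: the Gramian from
    below by \<open>e\<close>, that of \<open>Q\<close> from above by \<open>K\<close>.\<close>
  have "e / K * quad Q v \<le> obs_gram n A C v" if "v \<in> carrier_vec n" for v
  proof -
    have "e / K * quad Q v \<le> e / K * (K * (v \<bullet> v))"
      using e K that by (intro mult_left_mono) auto
    also have "\<dots> = e * (v \<bullet> v)" using K by simp
    also have "\<dots> \<le> obs_gram n A C v" using e(2)[OF that] gram[OF that] by simp
    finally show ?thesis .
  qed
  then show ?thesis using e K by (intro exI[of _ "e / K"]) auto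
qed

lemma funpow_step_uniformly_positive:
  "\<exists>c. 0 < c \<and> c < 1 \<and>
    (\<forall>Y\<in>psd n. \<forall>v\<in>carrier_vec n. c * \<tau> Y * quad Q v \<le> quad ((step ^^ n) Y) v)"
proof -
  obtain g where g: "g > 0"
    "\<And>X v. X \<in> psd n \<Longrightarrow> v \<in> carrier_vec n \<Longrightarrow> g * \<tau> X * obs_gram n A C v \<le> quad ((step ^^ n) X) v"
    using funpow_step_quad_ge by blast
  obtain e where e: "e > 0" "\<And>v. v \<in> carrier_vec n \<Longrightarrow> e * quad Q v \<le> obs_gram n A C v"
    using obs_gram_ge_Q by blast
  \<comment> \<open>The cap at 1/2 ensures \<open>c < 1\<close>, so that \<open>1 - c\<close> and
    \<open>c\<close> can later act as convex weights.\<close>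
  define c where "c = min (1 / 2) (g * e)"
  have "c * \<tau> Y * quad Q v \<le> quad ((step ^^ n) Y) v" if Y: "Y \<in> psd n" and v: "v \<in> carrier_vec n" for Y v
  proof -
    have "c * \<tau> Y * quad Q v \<le> (g * e) * \<tau> Y * quad Q v"
      using \<tau>_nonneg[OF Y] pos_def_quad_nonneg[OF Q v] by (intro mult_right_mono) (auto simp: c_def)
    also have "\<dots> = g * \<tau> Y * (e * quad Q v)" by simp
    also have "\<dots> \<le> g * \<tau> Y * obs_gram n A C v"
      using g(1) \<tau>_nonneg[OF Y] e(2)[OF v] by (intro mult_left_mono) auto
    also have "\<dots> \<le> quad ((step ^^ n) Y) v" by (rule g(2)[OF Y v])
    finally show ?thesis .
  qed
  then show ?thesis using g(1) e(1) by (intro exI[of _ c]) (auto simp: c_def)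
qed

section \<open>Contraction towards \<open>Q\<close> in the Hilbert metric\<close>

text \<open>\<open>hilbert_within X s\<close> holds when the Hilbert distance of \<open>X\<close> to \<open>Q\<close> is finite and at most \<open>s\<close>.\<close>

definition hilbert_within :: "real mat \<Rightarrow> real \<Rightarrow> bool" where
  "hilbert_within X s \<longleftrightarrow> X \<in> carrier_mat n n \<and> X\<^sup>T = X \<and>
    (\<exists>a b. 0 < a \<and> a \<le> b \<and> ln (b / a) \<le> s \<and>
      (\<forall>v\<in>carrier_vec n. a * quad Q v \<le> quad X v \<and> quad X v \<le> b * quad Q v))"

lemma hilbert_within_dist:
  assumes "hilbert_within X s"
  shows "hilbert_dist n X Q \<le> ereal s"
proof -
  obtain a b where ab: "0 < a" "a \<le> b" "ln (b / a) \<le> s"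
    "\<And>v. v \<in> carrier_vec n \<Longrightarrow> a * quad Q v \<le> quad X v"
    "\<And>v. v \<in> carrier_vec n \<Longrightarrow> quad X v \<le> b * quad Q v"
    and X: "X \<in> carrier_mat n n" "X\<^sup>T = X"
    using assms unfolding hilbert_within_def by blast
  have "hilbert_dist n X Q \<le> ereal (ln (b / a))"
    by (rule hilbert_dist_le[OF Q n_pos X ab(1,2,4,5)])
  also have "\<dots> \<le> ereal s" using ab(3) by simp
  finally show ?thesis .
qed

lemma \<tau>_bounds:
  assumes X: "X \<in> carrier_mat n n"
    and "\<And>v. v \<in> carrier_vec n \<Longrightarrow> a * quad Q v \<le> quad X v"
    and "\<And>v. v \<in> carrier_vec n \<Longrightarrow> quad X v \<le> b * quad Q v"
  shows "a \<le> \<tau> X" "\<tau> X \<le> b"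
proof -
  have "\<tau> (a \<cdot>\<^sub>m Q) \<le> \<tau> X" "\<tau> X \<le> \<tau> (b \<cdot>\<^sub>m Q)"
    using assms Q_carrier by (auto intro!: \<tau>_mono simp: quad_smult[OF Q_carrier])
  then show "a \<le> \<tau> X" "\<tau> X \<le> b" by (auto simp: \<tau>_smult[OF Q_carrier] \<tau>_Q)
qed

text \<open>The map preserves order and fixes \<open>Q\<close>, so the same \<open>a\<close> and
  \<open>b\<close> still work. This nonexpansiveness covers the steps left over after complete
  blocks of length \<open>n\<close>.\<close>

lemma hilbert_within_step:
  assumes "hilbert_within X s"
  shows "hilbert_within (step X) s"
proof -
  obtain a b where ab: "0 < a" "a \<le> b" "ln (b / a) \<le> s"
    and lo: "\<And>v. v \<in> carrier_vec n \<Longrightarrow> a * quad Q v \<le> quad X v"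
    and up: "\<And>v. v \<in> carrier_vec n \<Longrightarrow> quad X v \<le> b * quad Q v"
    and X: "X \<in> carrier_mat n n" "X\<^sup>T = X"
    using assms unfolding hilbert_within_def by blast
  note \<tau> = \<tau>_bounds[OF X(1) lo up]
  have "a * quad Q v \<le> quad (step X) v \<and> quad (step X) v \<le> b * quad Q v" if v: "v \<in> carrier_vec n" for v
  proof -
    define g where "g = (C *\<^sub>v v) \<bullet> (C *\<^sub>v v)"
    have g: "0 \<le> g" unfolding g_def by (rule scalar_prod_self_nonneg)
    have Av: "A *\<^sub>v v \<in> carrier_vec n" using A v by simp
    have "quad Q v = quad Q (A *\<^sub>v v) + g"
      using quad_step[OF Q_carrier v] by (simp add: step_Q \<tau>_Q g_def)
    moreover have "quad (step X) v = quad X (A *\<^sub>v v) + \<tau> X * g"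
      using quad_step[OF X(1) v] by (simp add: g_def)
    moreover have "a * g \<le> \<tau> X * g" "\<tau> X * g \<le> b * g"
      using \<tau> g by (auto intro: mult_right_mono)
    ultimately show ?thesis using lo[OF Av] up[OF Av] by (simp add: distrib_left)
  qed
  then show ?thesis
    unfolding hilbert_within_def using ab step_carrier[OF X(1)] step_sym[OF X] by blast
qed

lemma hilbert_within_funpow_step: "hilbert_within X s \<Longrightarrow> hilbert_within ((step ^^ k) X) s"
  by (induction k) (auto intro: hilbert_within_step)

lemma hilbert_within_contraction:
  "\<exists>\<theta>. 0 < \<theta> \<and> \<theta> < 1 \<and> (\<forall>X s. hilbert_within X s \<longrightarrow> hilbert_within ((step ^^ n) X) ((1 - \<theta>) * s))"
proof -
  obtain c where c: "0 < c" "c < 1"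
    and pos: "\<And>Y v. Y \<in> psd n \<Longrightarrow> v \<in> carrier_vec n \<Longrightarrow> c * \<tau> Y * quad Q v \<le> quad ((step ^^ n) Y) v"
    using funpow_step_uniformly_positive by blast
  obtain K where K: "1 \<le> K"
    and KY: "\<And>Y v. Y \<in> psd n \<Longrightarrow> v \<in> carrier_vec n \<Longrightarrow> quad Y v \<le> K * \<tau> Y * quad Q v"
    using psd_le_trace_pos_def[OF Q n_pos] unfolding \<tau>_def by blast
  \<comment> \<open>The rate is the one from \<open>ln_ratio_contraction\<close>; it depends only on
    \<open>c\<close> and \<open>K\<close>, hence is uniform in \<open>X\<close> and
    \<open>s\<close>.\<close>
  define \<theta> where "\<theta> = (c / K) / (1 - c + c / K)"
  have cK: "0 < c / K" using c K by simp
  then have "0 < 1 - c + c / K" "c / K < 1 - c + c / K" using c by simp_all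
  then have \<theta>: "0 < \<theta>" "\<theta> < 1"
    unfolding \<theta>_def using cK by (simp_all only: divide_pos_pos divide_less_eq_1_pos)
  have "hilbert_within ((step ^^ n) X) ((1 - \<theta>) * s)" if w: "hilbert_within X s" for X s
  proof -
    obtain a b0 where ab0: "0 < a" "a \<le> b0" "ln (b0 / a) \<le> s"
      and lo: "\<And>v. v \<in> carrier_vec n \<Longrightarrow> a * quad Q v \<le> quad X v"
      and up0: "\<And>v. v \<in> carrier_vec n \<Longrightarrow> quad X v \<le> b0 * quad Q v"
      and X: "X \<in> carrier_mat n n" "X\<^sup>T = X"
      using w unfolding hilbert_within_def by blast
    have Xpsd: "X \<in> psd n"
    proof -
      have "0 \<le> quad X v" if "v \<in> carrier_vec n" for v
        using lo[OF that] pos_def_quad_nonneg[OF Q that] ab0(1) by (smt (verit) mult_nonneg_nonneg)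
      then show ?thesis using X by (simp add: psd_def quad_def)
    qed
    define l where "l = \<tau> X"
    \<comment> \<open>The given upper factor \<open>b0\<close> may be arbitrarily large. Cutting it
      at \<open>K * l\<close> keeps it an upper factor, because \<open>X\<close> lies below
      \<open>K * l\<close> times \<open>Q\<close>, and supplies the hypothesis
      \<open>b \<le> K * l\<close> of \<open>ln_ratio_contraction\<close>.\<close>
    define b where "b = min b0 (K * l)"
    have al: "a \<le> l" unfolding l_def by (rule \<tau>_bounds[OF X(1) lo up0])
    have "l \<le> K * l" using K al ab0(1) by simp
    with al have "a \<le> K * l" by (rule order_trans)
    then have ab: "a \<le> b" using ab0 by (simp add: b_def)
    have up: "quad X v \<le> b * quad Q v" if "v \<in> carrier_vec n" for v
      using up0[OF that] KY[OF Xpsd that] by (simp add: b_def l_def min_def)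
    have lb: "l \<le> b" unfolding l_def by (rule \<tau>_bounds[OF X(1) lo up])
    have sm: "t \<cdot>\<^sub>m Q \<in> carrier_mat n n" for t
      using Q_carrier by simp
    define T where "T = (step ^^ n) X"
    have T: "T \<in> carrier_mat n n" unfolding T_def by (rule funpow_step_carrier[OF X(1)])
    have Y: "X - a \<cdot>\<^sub>m Q \<in> psd n" "b \<cdot>\<^sub>m Q - X \<in> psd n"
      using loewner_le_smult_iff[OF X Q_carrier Q_sym] lo up unfolding loewner_le_def by auto
    have "hilbert_within T ((1 - \<theta>) * ln (b / a))"
    proof -
      define a' b' where "a' = (1 - c) * a + c * l" and "b' = (1 - c) * b + c * l"
      have "0 < a'" using ab0(1) al c by (auto simp: a'_def intro!: add_pos_pos)
      moreover have "a' \<le> b'" using ab c by (simp add: a'_def b'_def)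
      moreover have "ln (b' / a') \<le> (1 - \<theta>) * ln (b / a)"
        unfolding a'_def b'_def \<theta>_def
        by (rule ln_ratio_contraction[OF ab0(1) ab _ c K]) (simp add: b_def)
      moreover have "a' * quad Q v \<le> quad T v \<and> quad T v \<le> b' * quad Q v" if v: "v \<in> carrier_vec n" for v
      proof -
        have "\<tau> (X - a \<cdot>\<^sub>m Q) = l - a" "\<tau> (b \<cdot>\<^sub>m Q - X) = b - l"
          by (auto simp: \<tau>_diff[OF X(1) sm] \<tau>_diff[OF sm X(1)] \<tau>_smult[OF Q_carrier] \<tau>_Q l_def)
        moreover have "quad ((step ^^ n) (X - a \<cdot>\<^sub>m Q)) v = quad T v - a * quad Q v"
          "quad ((step ^^ n) (b \<cdot>\<^sub>m Q - X)) v = b * quad Q v - quad T v"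
          unfolding funpow_step_diff[OF X(1) sm] funpow_step_diff[OF sm X(1)]
            funpow_step_smult_Q T_def[symmetric] quad_minus[OF T sm v] quad_minus[OF sm T v]
            quad_smult[OF Q_carrier v] by auto
        \<comment> \<open>Uniform positivity is applied to both differences; collecting the
          multiples of \<open>quad Q v\<close> produces exactly \<open>a'\<close> and
          \<open>b'\<close>.\<close>
        ultimately have "c * (l - a) * quad Q v \<le> quad T v - a * quad Q v"
          "c * (b - l) * quad Q v \<le> b * quad Q v - quad T v"
          using pos[OF Y(1) v] pos[OF Y(2) v] by auto
        then show ?thesis by (simp add: a'_def b'_def algebra_simps)
      qed
      moreover have "T\<^sup>T = T"
        using funpow_step_psd[OF Xpsd] by (simp add: T_def psd_def)
      ultimately show ?thesis unfolding hilbert_within_def using T by blast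
    qed
    moreover have "(1 - \<theta>) * ln (b / a) \<le> (1 - \<theta>) * s"
    proof -
      have "b / a \<le> b0 / a" using ab0 by (intro divide_right_mono) (auto simp: b_def)
      then have "ln (b / a) \<le> ln (b0 / a)" using ab ab0 by (intro ln_mono) auto
      then show ?thesis using ab0(3) \<theta> by (intro mult_left_mono) auto
    qed
    ultimately show ?thesis
      unfolding T_def hilbert_within_def by (meson order_trans)
  qed
  then show ?thesis using \<theta> by blast
qed

text \<open>The exponent carries \<open>Suc k\<close> because the sequence starts at index 1, so the
  \<open>k\<close>-th iterate of its first term has index \<open>k + 1\<close>.\<close>

lemma hilbert_dist_funpow_step:
  "\<exists>\<mu>>0. \<exists>\<kappa>>0. \<forall>X\<in>psd n. \<forall>k. hilbert_dist n ((step ^^ k) X) Q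
      \<le> ereal (\<mu> * exp (- \<kappa> * real (Suc k))) * hilbert_dist n X Q"
proof -
  obtain \<theta> where \<theta>: "0 < \<theta>" "\<theta> < 1"
    and contr: "\<And>X s. hilbert_within X s \<Longrightarrow> hilbert_within ((step ^^ n) X) ((1 - \<theta>) * s)"
    using hilbert_within_contraction by blast
  have iter: "hilbert_within ((step ^^ (q * n)) X) ((1 - \<theta>) ^ q * s)" if "hilbert_within X s" for X s q
  proof (induction q)
    case (Suc q)
    then show ?case
      using contr[OF Suc] by (simp add: funpow_add mult.assoc)
  qed (use that in simp)
  have "hilbert_dist n ((step ^^ k) X) Q
      \<le> ereal (exp \<theta> * exp (- (\<theta> / real n) * real (Suc k))) * hilbert_dist n X Q"
    if X: "X \<in> psd n" for X k
  proof (cases "hilbert_dist n X Q = \<infinity>")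
    \<comment> \<open>The right-hand side is infinite as well, its other factor being
      positive.\<close>
    case True
    then show ?thesis by simp
  next
    case False
    obtain a b where ab: "0 < a" "a \<le> b" "hilbert_dist n X Q = ereal (ln (b / a))"
      "\<And>v. v \<in> carrier_vec n \<Longrightarrow> a * quad Q v \<le> quad X v"
      "\<And>v. v \<in> carrier_vec n \<Longrightarrow> quad X v \<le> b * quad Q v"
      using hilbert_dist_finite_bounds[OF Q n_pos X False] by blast
    define s where "s = ln (b / a)"
    have s: "0 \<le> s" using ab by (simp add: s_def)
    have "hilbert_within X s" unfolding hilbert_within_def s_def using ab X by (auto simp: psd_def)
    \<comment> \<open>The \<open>k\<close> steps split into \<open>k div n\<close> contracting
      blocks followed by \<open>k mod n\<close> nonexpansive steps.\<close>
    then have "hilbert_within ((step ^^ (k mod n)) ((step ^^ (k div n * n)) X)) ((1 - \<theta>) ^ (k div n) * s)"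
      by (intro hilbert_within_funpow_step iter)
    then have "hilbert_within ((step ^^ k) X) ((1 - \<theta>) ^ (k div n) * s)"
      by (simp flip: funpow_add[unfolded comp_def, THEN fun_cong])
    then have "hilbert_dist n ((step ^^ k) X) Q \<le> ereal ((1 - \<theta>) ^ (k div n) * s)"
      by (rule hilbert_within_dist)
    also have "(1 - \<theta>) ^ (k div n) * s \<le> exp \<theta> * exp (- (\<theta> / real n) * real (Suc k)) * s"
    proof (rule mult_right_mono[OF _ s])
      have "(1 - \<theta>) ^ (k div n) \<le> exp (- \<theta>) ^ (k div n)"
        using \<theta> exp_ge_add_one_self[of "- \<theta>"] by (intro power_mono) auto
      also have "\<dots> = exp (- \<theta> * real (k div n))"
        by (simp add: exp_of_nat_mult[symmetric] mult.commute)
      \<comment> \<open>The constant \<open>exp \<theta>\<close> pays for the incomplete last block,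
        since \<open>k + 1\<close> is at most \<open>(k div n + 1) * n\<close>.\<close>
      also have "\<dots> \<le> exp (\<theta> + - (\<theta> / real n) * real (Suc k))"
      proof -
        have "k mod n < n" using n_pos by simp
        then have "Suc k \<le> (k div n + 1) * n"
          using div_mult_mod_eq[of k n] unfolding add_mult_distrib by linarith
        then have "real (Suc k) \<le> (real (k div n) + 1) * real n"
          by (metis of_nat_1 of_nat_add of_nat_le_iff of_nat_mult)
        then have "real (Suc k) / real n \<le> real (k div n) + 1"
          using n_pos by (simp add: divide_le_eq)
        then have "\<theta> * (real (Suc k) / real n) \<le> \<theta> * (real (k div n) + 1)"
          using \<theta> by (intro mult_left_mono) auto
        then show ?thesis by (simp add: distrib_left del: of_nat_Suc)
      qed
      also have "\<dots> = exp \<theta> * exp (- (\<theta> / real n) * real (Suc k))" by (rule exp_add)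
      finally show "(1 - \<theta>) ^ (k div n) \<le> exp \<theta> * exp (- (\<theta> / real n) * real (Suc k))" .
    qed
    finally show ?thesis using ab(3) by (simp add: s_def)
  qed
  then show ?thesis
    using \<theta> n_pos by (intro exI[of _ "exp \<theta>"] conjI exI[of _ "\<theta> / real n"]) auto
qed

end

theorem mainTheorem6:
  fixes n m :: nat and A C :: "real mat"
  assumes "A \<in> carrier_mat n n"
    and "C \<in> carrier_mat m n"
    and "schur_stable A"
    and "observable n m A C"
  shows "(\<exists>!Q. lyapunov_solution n A C Q) \<and>
    (\<forall>Q. lyapunov_solution n A C Q \<longrightarrow>
      (\<exists>\<alpha>>0. \<exists>\<mu>>0. \<exists>\<kappa>>0. \<forall>X :: nat \<Rightarrow> real mat.
        X 1 \<in> psd n \<and> X 1 \<noteq> 0\<^sub>m n n \<and>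
        (\<forall>k\<ge>1. X (Suc k) = A\<^sup>T * X k * A + (\<alpha> * mat_trace (X k)) \<cdot>\<^sub>m (C\<^sup>T * C)) \<longrightarrow>
        (\<forall>k\<ge>1. hilbert_dist n (X k) Q
                \<le> ereal (\<mu> * exp (- \<kappa> * real k)) * hilbert_dist n (X 1) Q)))"
proof (intro conjI allI impI)
  show "\<exists>!Q. lyapunov_solution n A C Q"
    by (rule ex1_lyapunov_solution[OF assms])
  fix Q assume sol: "lyapunov_solution n A C Q"
  then have Q: "pos_def n Q" and Qc: "Q \<in> carrier_mat n n"
    by (auto simp: lyapunov_solution_def pos_def_def)
  show "\<exists>\<alpha>>0. \<exists>\<mu>>0. \<exists>\<kappa>>0. \<forall>X :: nat \<Rightarrow> real mat.
        X 1 \<in> psd n \<and> X 1 \<noteq> 0\<^sub>m n n \<and>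
        (\<forall>k\<ge>1. X (Suc k) = A\<^sup>T * X k * A + (\<alpha> * mat_trace (X k)) \<cdot>\<^sub>m (C\<^sup>T * C)) \<longrightarrow>
        (\<forall>k\<ge>1. hilbert_dist n (X k) Q
                \<le> ereal (\<mu> * exp (- \<kappa> * real k)) * hilbert_dist n (X 1) Q)"
  proof (cases "n = 0")
    \<comment> \<open>In dimension 0 the only matrix is zero, so no admissible initial value exists
      and any constants do.\<close>
    case True
    have "Y = 0\<^sub>m n n" if "Y \<in> psd n" for Y
      using that True by (intro eq_matI) (auto simp: psd_def)
    then show ?thesis by (intro exI[of _ "1 :: real"] conjI) auto
  next
    case False
    interpret lyapunov_iteration n m A C Q
    proof
      show "A\<^sup>T * Q * A + C\<^sup>T * C = Q"
        using sol lyapunov_eq_iff[OF assms(1,2) Qc] by (simp add: lyapunov_solution_def)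
    qed (use False assms Q observable_obs_gram_pos in auto)
    obtain \<mu> \<kappa> where \<mu>\<kappa>: "\<mu> > 0" "\<kappa> > 0"
      "\<And>X k. X \<in> psd n \<Longrightarrow> hilbert_dist n ((step ^^ k) X) Q
        \<le> ereal (\<mu> * exp (- \<kappa> * real (Suc k))) * hilbert_dist n X Q"
      using hilbert_dist_funpow_step by blast
    \<comment> \<open>With \<alpha> equal to \<open>1 / mat_trace Q\<close> the recursion is
      iteration of \<open>step\<close>, and \<open>X k\<close> is reached from \<open>X 1\<close>
      after \<open>k - 1\<close> steps.\<close>
    have "hilbert_dist n (X k) Q \<le> ereal (\<mu> * exp (- \<kappa> * real k)) * hilbert_dist n (X 1) Q"
      if X1: "X 1 \<in> psd n" and k: "1 \<le> k"
        and rec: "\<forall>k\<ge>1. X (Suc k) = A\<^sup>T * X k * A + (1 / mat_trace Q * mat_trace (X k)) \<cdot>\<^sub>m (C\<^sup>T * C)"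
      for X :: "nat \<Rightarrow> real mat" and k
    proof -
      have "X (Suc j) = (step ^^ j) (X 1)" for j
      proof (induction j)
        case (Suc j)
        have "X (Suc (Suc j)) = step (X (Suc j))"
          using rec[rule_format, of "Suc j"] by (simp add: step_def \<tau>_def)
        then show ?case using Suc by simp
      qed simp
      from this[of "k - 1"] show ?thesis using \<mu>\<kappa>(3)[OF X1, of "k - 1"] k by simp
    qed
    then show ?thesis
      using \<mu>\<kappa>(1,2) trace_Q_pos
      by (intro exI[of _ "1 / mat_trace Q"] conjI exI[of _ \<mu>] exI[of _ \<kappa>]) auto
  qed
qed

end
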